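(* Let a probability measure $\mathbb P_0$ on $\mathcal Y$, a set $\mathcal U_{data}$ of probability measures on $\mathcal Y$ (both possibly depending on the data $\xi_1,\dots,\xi_n$), and $\epsilon>0$ be given, and suppose there exists $\delta_\epsilon>0$ small enough such that $$M(\mathbb P_0,\mathcal U_{data},\delta_\epsilon)\le\epsilon .$$ Let $\hat x^{MC}$ be the solution of the sampled problem $$\min_{x\in\mathcal X}\ c^Tx\quad\text{s.t.}\quad x\in\mathcal X_{\xi_i^{MC}},\ i=1,\dots,N,$$ with $N=N_{exact}(\delta_\epsilon,\beta,d)$ and $\xi^{MC}_1,\dots,\xi^{MC}_N$ drawn i.i.d. from $\mathbb P_0$ (conditionally on the data). Then $\hat x^{MC}$ is feasible for the distributionally robust problem $$\min_{x\in\mathcal X}\ c^Tx\quad\text{s.t.}\quad \min_{\mathbb Q\in\mathcal U_{data}}\mathbb Q(x\in\mathcal X_\xi)\ge 1-\epsilon$$ with confidence at least $1-\beta$, i.e. conditionally on the data, with probability at least $1-\beta$ over the Monte Carlo samples. Furthermore, if $$\mathbb P_{data}(\mathbb P\in\mathcal U_{data})\ge 1-\alpha ,$$ then $\hat x^{MC}$ is feasible for $$\min_{x\in\mathcal X}\ c^Tx\quad\text{s.t.}\quad \mathbb P(x\in\mathcal X_\xi)\ge 1-\epsilon$$ with confidence at least $1-\alpha-\beta$, i.e. with probability at least $1-\alpha-\beta$ over the joint randomness of the data and the Monte Carlo samples.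
   Context: $\xi$ is a random element of a space $\mathcal Y$ with true law $\mathbb P$; $\mathcal X\subseteq\mathbb R^d$, $c\in\mathbb R^d$, and for each $\xi\in\mathcal Y$, $\mathcal X_\xi\subseteq\mathcal X$ is a given set. Standing assumptions: $\mathcal X_\xi$ is convex for every $\xi$, and every instance of the sampled problem $\min\{c^Tx: x\in\mathcal X,\ x\in\mathcal X_{\xi_i}, i=1,\dots,N\}$ has a feasible region with nonempty interior and a unique optimal solution. All sets and maps are assumed measurable as needed. The data $\xi_1,\dots,\xi_n$ are i.i.d. from $\mathbb P$, and $\mathbb P_{data}$ denotes the law of the data. $\alpha,\beta\in(0,1)$. For a probability measure $\mathbb P_0$, a set $\mathcal U$ of probability measures on $\mathcal Y$, and $\delta>0$, $$M(\mathbb P_0,\mathcal U,\delta)=\sup\{\mathbb Q(A):\ \mathbb Q\in\mathcal U,\ A\subset\mathcal Y\text{ measurable},\ \mathbb P_0(A)\le\delta\}.$$ For $\epsilon,\beta>0$, $$N_{exact}(\epsilon,\beta,d)=\min\Big\{n:\ \sum_{i=0}^{d-1}\binom ni\epsilon^i(1-\epsilon)^{n-i}\le\beta\Big\}.$$ When $\mathbb P_0,\mathcal U_{data},\delta_\epsilon$ depend on the data, the condition $M(\mathbb P_0,\mathcal U_{data},\delta_\epsilon)\le\epsilon$ is understood to hold for every realization of the data. *)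

theory Defs
  imports "HOL-Probability.Probability"
begin

(* The supremum is taken in ereal, so that it is meaningful also for an empty U. *)
definition worst_case :: "'y measure \<Rightarrow> 'y measure set \<Rightarrow> real \<Rightarrow> ereal" where
  "worst_case P0 U \<delta> =
     Sup {ereal (measure Q A) | Q A. Q \<in> U \<and> A \<in> sets P0 \<and> measure P0 A \<le> \<delta>}"

definition N_exact :: "real \<Rightarrow> real \<Rightarrow> nat \<Rightarrow> nat" where
  "N_exact \<epsilon> \<beta> d =
     (LEAST n. (\<Sum>i<d. real (n choose i) * \<epsilon> ^ i * (1 - \<epsilon>) ^ (n - i)) \<le> \<beta>)"

definition sampled_region ::
  "'a set \<Rightarrow> ('y \<Rightarrow> 'a set) \<Rightarrow> nat \<Rightarrow> (nat \<Rightarrow> 'y) \<Rightarrow> 'a set" where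
  "sampled_region X Xs N s = {x \<in> X. \<forall>i<N. x \<in> Xs (s i)}"

(* arg_min makes an arbitrary choice among the minimisers; it is used only where the
   minimiser is assumed to exist uniquely. *)
definition sampled_solution ::
  "'a::real_inner \<Rightarrow> 'a set \<Rightarrow> ('y \<Rightarrow> 'a set) \<Rightarrow> nat \<Rightarrow> (nat \<Rightarrow> 'y) \<Rightarrow> 'a" where
  "sampled_solution c X Xs N s = arg_min (\<lambda>x. c \<bullet> x) (\<lambda>x. x \<in> sampled_region X Xs N s)"

definition cc_feasible ::
  "'a set \<Rightarrow> ('y \<Rightarrow> 'a set) \<Rightarrow> 'y measure \<Rightarrow> real \<Rightarrow> 'a \<Rightarrow> bool" where
  "cc_feasible X Xs P \<epsilon> x \<longleftrightarrow> x \<in> X \<and> \<P>(\<xi> in P. x \<in> Xs \<xi>) \<ge> 1 - \<epsilon>"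

(* The worst-case probability is an infimum in ereal; it need not be attained, and it is
   infinite for an empty U. *)
definition dro_feasible ::
  "'a set \<Rightarrow> ('y \<Rightarrow> 'a set) \<Rightarrow> 'y measure set \<Rightarrow> real \<Rightarrow> 'a \<Rightarrow> bool" where
  "dro_feasible X Xs U \<epsilon> x \<longleftrightarrow>
     x \<in> X \<and> (INF Q\<in>U. ereal (\<P>(\<xi> in Q. x \<in> Xs \<xi>))) \<ge> ereal (1 - \<epsilon>)"

definition data_law :: "nat \<Rightarrow> 'y measure \<Rightarrow> (nat \<Rightarrow> 'y) measure" where
  "data_law n P = (\<Pi>\<^sub>M i\<in>{..<n}. P)"

(* The Monte Carlo sample size depends on the data.  To have one sample space for all sizes,
   the samples are the first N coordinates of an infinite i.i.d. sequence. *)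
definition mc_law :: "'y measure \<Rightarrow> (nat \<Rightarrow> 'y) measure" where
  "mc_law P0 = (\<Pi>\<^sub>M i\<in>UNIV. P0)"

(* Joint law of data and Monte Carlo sequence: the data \<omega> follow data_law n P and,
   conditionally on \<omega>, the sequence follows mc_law (P0 \<omega>). *)
definition joint_law ::
  "nat \<Rightarrow> 'y measure \<Rightarrow> ((nat \<Rightarrow> 'y) \<Rightarrow> 'y measure) \<Rightarrow> ((nat \<Rightarrow> 'y) \<times> (nat \<Rightarrow> 'y)) measure" where
  "joint_law n P P0 =
     data_law n P \<bind> (\<lambda>\<omega>. distr (mc_law (P0 \<omega>)) (data_law n P \<Otimes>\<^sub>M mc_law P) (Pair \<omega>))"

end

theory Submission
  imports Defs "HOL-Real_Asymp.Real_Asymp"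
begin

text \<open>If \<open>P0\<close> gives the sampled solution a violation probability of at most \<open>\<delta>\<close>, then every
  \<open>Q\<close> in the ambiguity set gives it at most \<open>\<epsilon>\<close>, so everything rests on the exact bound of Campi and
  Garatti for the violation probability of the solution of a scenario program. To prove it, draw
  \<open>K > N\<close> scenarios and ask how many \<open>N\<close>-subsets of them have a solution violating at least \<open>k\<close>
  of the \<open>K\<close> constraints. For fixed scenarios, a perturbation makes the finite convex program
  generic without losing violations. Then every set of at least \<open>d\<close> constraints has exactly one
  \<open>d\<close>-element basis, and this alone determines the number of subsets in question, which can be read
  off from the model in which the basis of a set of numbers consists of its \<open>d\<close> smallest elements.
  By exchangeability and Hoeffding's inequality the count bounds the probability of a large violation,
  and \<open>K \<longrightarrow> \<infinity>\<close> turns the hypergeometric tail into the binomial one.\<close>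

section \<open>Counting bases\<close>

text \<open>The obstacle is degeneracy: an optimum may be determined by fewer than d constraints, or
  by several different sets of them, and then the counts are not determined. The original program is
  a poor place to break ties, since its constraint sets need not be closed and without constraints
  there may be no optimum. Minimising the distance to a far point instead gives every subset exactly
  one optimum, and enlarging the sets by radii in general position keeps an optimum off the
  boundaries of constraints outside its subset. Both changes are small, and the finitely many
  violations that must survive have positive distance once the sets are compact. Bases that are too
  small remain possible and are padded by an index rule, at the cost of an inequality in the
  harmless direction. The margin lost to some \<epsilon>' < \<epsilon> is recovered by continuity of
  the binomial tail.\<close>

definition selects :: "nat \<Rightarrow> (nat set \<Rightarrow> nat set) \<Rightarrow> nat set \<Rightarrow> nat set \<Rightarrow> bool" where
  "selects d V S B \<longleftrightarrow> card B = d \<and> B \<subseteq> S \<and> V B \<inter> S = {}"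

text \<open>Think of \<open>V B\<close> as the constraints violated at the optimum of
  \<open>B\<close>; \<open>selects d V S B\<close> then says that \<open>B\<close> already
  determines the optimum of \<open>S\<close>. The geometry of the program enters the counting only
  through this interface.\<close>

definition basis_system :: "nat set \<Rightarrow> nat \<Rightarrow> (nat set \<Rightarrow> nat set) \<Rightarrow> bool" where
  "basis_system H d V \<longleftrightarrow> (\<forall>B\<subseteq>H. V B \<subseteq> H - B) \<and>
     (\<forall>S\<subseteq>H. d \<le> card S \<longrightarrow> (\<exists>!B. selects d V S B))"

definition level :: "nat set \<Rightarrow> nat \<Rightarrow> (nat set \<Rightarrow> nat set) \<Rightarrow> nat \<Rightarrow> nat" where
  "level H d V j = card {B. B \<subseteq> H \<and> card B = d \<and> card (V B) = j}"

lemma card_subsets_between: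
  assumes "finite G" "B \<subseteq> G" "card B \<le> M"
  shows "card {S. B \<subseteq> S \<and> S \<subseteq> G \<and> card S = M} = (card G - card B) choose (M - card B)"
proof -
  have fB: "finite B" using assms finite_subset by blast
  have "bij_betw (\<lambda>T. T \<union> B) {T. T \<subseteq> G - B \<and> card T = M - card B}
      {S. B \<subseteq> S \<and> S \<subseteq> G \<and> card S = M}"
  proof (rule bij_betw_byWitness[where f' = "\<lambda>S. S - B"])
    show "(\<lambda>T. T \<union> B) ` {T. T \<subseteq> G - B \<and> card T = M - card B}
        \<subseteq> {S. B \<subseteq> S \<and> S \<subseteq> G \<and> card S = M}"
    proof (safe; simp?)
      fix T assume T: "T \<subseteq> G - B" "card T = M - card B"
      have "card (T \<union> B) = card T + card B"
        by (rule card_Un_disjoint) (use T assms(1) fB in \<open>auto intro: finite_subset[of T G]\<close>)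
      then show "card (T \<union> B) = M" using T assms by simp
    qed (use assms in auto)
    show "(\<lambda>S. S - B) ` {S. B \<subseteq> S \<and> S \<subseteq> G \<and> card S = M}
        \<subseteq> {T. T \<subseteq> G - B \<and> card T = M - card B}"
      using fB by (auto simp: card_Diff_subset)
  qed auto
  then have "card {S. B \<subseteq> S \<and> S \<subseteq> G \<and> card S = M} =
      card {T. T \<subseteq> G - B \<and> card T = M - card B}"
    by (simp add: bij_betw_same_card)
  also have "\<dots> = (card G - card B) choose (M - card B)"
    using assms fB by (subst n_subsets) (auto simp: card_Diff_subset)
  finally show ?thesis .
qed

text \<open>The sets with basis \<open>B\<close> are precisely those between \<open>B\<close> and
  \<open>H - V B\<close>. Uniqueness of the basis makes these families disjoint, so their sizes add
  up, and each size depends on \<open>B\<close> only through \<open>card (V B)\<close>.\<close>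

lemma card_selects:
  assumes H: "finite H" and V: "basis_system H d V" and M: "d \<le> M"
  shows "card {S. S \<subseteq> H \<and> card S = M \<and> (\<exists>B. selects d V S B \<and> P (card (V B)))} =
     (\<Sum>j | j \<le> card H - d \<and> P j. level H d V j * ((card H - d - j) choose (M - d)))"
proof -
  define \<B> where "\<B> = {B. B \<subseteq> H \<and> card B = d \<and> P (card (V B))}"
  define F where "F B = {S. B \<subseteq> S \<and> S \<subseteq> H - V B \<and> card S = M}" for B
  have fB: "finite \<B>" using H by (auto simp: \<B>_def)
  have VB: "V B \<subseteq> H - B" if "B \<subseteq> H" for B using V that by (auto simp: basis_system_def)
  have *: "{S. S \<subseteq> H \<and> card S = M \<and> (\<exists>B. selects d V S B \<and> P (card (V B)))} = (\<Union>B\<in>\<B>. F B)"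
    by (auto simp: \<B>_def F_def selects_def)
  have un: "B = B'" if "B \<in> \<B>" "B' \<in> \<B>" "S \<in> F B" "S \<in> F B'" for B B' S
  proof -
    have "selects d V S B" "selects d V S B'" "S \<subseteq> H" "d \<le> card S"
      using that M by (auto simp: selects_def \<B>_def F_def)
    then show ?thesis using V unfolding basis_system_def by blast
  qed
  have cF: "card (F B) = (card H - d - card (V B)) choose (M - d)" if "B \<in> \<B>" for B
  proof -
    have B: "B \<subseteq> H" "card B = d" using that by (auto simp: \<B>_def)
    have "card (F B) = (card (H - V B) - card B) choose (M - card B)"
      unfolding F_def using H B VB[of B] M by (intro card_subsets_between) auto
    also have "card (H - V B) = card H - card (V B)"
      using VB[of B] B H by (intro card_Diff_subset) (auto intro: finite_subset)
    finally show ?thesis using B by (simp add: diff_diff_left add.commute)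
  qed
  have le: "card (V B) \<le> card H - d" if "B \<in> \<B>" for B
  proof -
    have "card (V B) \<le> card (H - B)" using VB[of B] that H by (intro card_mono) (auto simp: \<B>_def)
    also have "\<dots> = card H - d" using that H by (subst card_Diff_subset) (auto simp: \<B>_def intro: finite_subset)
    finally show ?thesis .
  qed
  have "card (\<Union>B\<in>\<B>. F B) = (\<Sum>B\<in>\<B>. card (F B))"
    by (rule card_UN_disjoint) (use fB un H in \<open>auto simp: F_def\<close>)
  also have "\<dots> = (\<Sum>B\<in>\<B>. (card H - d - card (V B)) choose (M - d))"
    using cF by simp
  also have "\<dots> = (\<Sum>j | j \<le> card H - d \<and> P j. \<Sum>B\<in>{B\<in>\<B>. card (V B) = j}. (card H - d - card (V B)) choose (M - d))"
    by (rule sum.group[symmetric]) (use fB le in \<open>auto simp: \<B>_def\<close>)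
  also have "\<dots> = (\<Sum>j | j \<le> card H - d \<and> P j. level H d V j * ((card H - d - j) choose (M - d)))"
  proof (rule sum.cong[OF refl])
    fix j assume j: "j \<in> {j. j \<le> card H - d \<and> P j}"
    then have "{B\<in>\<B>. card (V B) = j} = {B. B \<subseteq> H \<and> card B = d \<and> card (V B) = j}"
      by (auto simp: \<B>_def)
    then show "(\<Sum>B\<in>{B\<in>\<B>. card (V B) = j}. (card H - d - card (V B)) choose (M - d)) =
       level H d V j * ((card H - d - j) choose (M - d))"
      by (simp add: level_def)
  qed
  finally show ?thesis using * by simp
qed

text \<open>Counting the sets of each cardinality \<open>M\<close> by their basis gives a triangular linear system
  for the numbers \<open>level H d V j\<close>.\<close>
lemma level_unique:
  assumes H: "finite H" and V: "basis_system H d V" and W: "basis_system H d W"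
    and "j \<le> card H - d" "d \<le> card H"
  shows "level H d V j = level H d W j"
  using assms(4)
proof (induction j rule: less_induct)
  case (less j)
  \<comment> \<open>For this cardinality level \<open>i\<close> has the coefficient
    \<open>(card H - d - i) choose (card H - d - j)\<close>, which is 0 for \<open>i > j\<close> and
    1 for \<open>i = j\<close>; the lower levels are known by induction.\<close>
  define M where "M = card H - j"
  have M: "d \<le> M" "M - d = card H - d - j" using less.prems assms(5) by (auto simp: M_def)
  have all: "card {S. S \<subseteq> H \<and> card S = M} =
      (\<Sum>i\<le>card H - d. level H d U i * ((card H - d - i) choose (M - d)))"
    if U: "basis_system H d U" for U
  proof -
    have "\<exists>B. selects d U S B" if "S \<subseteq> H" "card S = M" for S
    proof (rule ex1_implies_ex)
      show "\<exists>!B. selects d U S B" using U that M(1) by (simp add: basis_system_def)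
    qed
    then have "{S. S \<subseteq> H \<and> card S = M} = {S. S \<subseteq> H \<and> card S = M \<and> (\<exists>B. selects d U S B \<and> True)}"
      by (intro Collect_cong) (simp cong: conj_cong)
    then show ?thesis
      using card_selects[OF H U M(1), of "\<lambda>_. True"] by (simp add: atMost_def)
  qed
  have split: "(\<Sum>i\<le>card H - d. level H d U i * ((card H - d - i) choose (M - d))) =
      (\<Sum>i<j. level H d U i * ((card H - d - i) choose (M - d))) + level H d U j" for U
  proof -
    have "(\<Sum>i\<le>card H - d. level H d U i * ((card H - d - i) choose (M - d))) =
       (\<Sum>i\<le>j. level H d U i * ((card H - d - i) choose (M - d)))"
      by (rule sum.mono_neutral_right) (use less.prems M in \<open>auto intro!: binomial_eq_0\<close>)
    also have "\<dots> = (\<Sum>i<j. level H d U i * ((card H - d - i) choose (M - d))) + level H d U j"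
      using M by (simp flip: lessThan_Suc_atMost)
    finally show ?thesis .
  qed
  have "(\<Sum>i<j. level H d V i * ((card H - d - i) choose (M - d))) =
      (\<Sum>i<j. level H d W i * ((card H - d - i) choose (M - d)))"
    using less by (intro sum.cong) auto
  then show ?case using all[OF V] all[OF W] split[of V] split[of W] by linarith
qed

section \<open>The model whose bases are the smallest indices\<close>

lemma initial_segment_unique:
  fixes T :: "nat set"
  assumes "E \<subseteq> T" "E' \<subseteq> T" "finite E" "finite E'" "card E = card E'"
    and "\<forall>t\<in>T - E. \<forall>u\<in>E. u < t" "\<forall>t\<in>T - E'. \<forall>u\<in>E'. u < t"
  shows "E = E'"
proof (rule ccontr)
  assume "E \<noteq> E'"
  then have "\<not> E \<subseteq> E'" "\<not> E' \<subseteq> E"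
    using card_subset_eq[OF assms(4)] card_subset_eq[OF assms(3)] assms(5) by auto
  then obtain u t where "u \<in> E - E'" "t \<in> E' - E" by blast
  then have "u < t" "t < u" using assms by auto
  then show False by simp
qed

lemma initial_segment_exists:
  fixes T :: "nat set"
  assumes "e \<le> card T" "finite T"
  shows "\<exists>E\<subseteq>T. card E = e \<and> (\<forall>t\<in>T - E. \<forall>u\<in>E. u < t)"
  using assms(1)
proof (induction e)
  case 0 then show ?case by (intro exI[of _ "{}"]) auto
next
  case (Suc e)
  then obtain E where E: "E \<subseteq> T" "card E = e" "\<forall>t\<in>T - E. \<forall>u\<in>E. u < t" by auto
  have ne: "T - E \<noteq> {}" using E Suc.prems assms(2) by auto
  define m where "m = Min (T - E)"
  have m: "m \<in> T - E" "\<And>t. t \<in> T - E \<Longrightarrow> m \<le> t" using Min_in[of "T - E"] ne assms(2) by (auto simp: m_def)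
  have fE: "finite E" using E assms(2) finite_subset by blast
  show ?case
  proof (intro exI[of _ "insert m E"] conjI ballI)
    fix t u assume t: "t \<in> T - insert m E" and u: "u \<in> insert m E"
    then show "u < t" using m(2)[of t] E(3) by (cases "u = m") auto
  qed (use m E fE in auto)
qed

text \<open>The presence of such an index stops \<open>B\<close> from consisting of the smallest
  elements, so it plays the part of a violated constraint.\<close>

definition smaller_outside :: "nat set \<Rightarrow> nat set \<Rightarrow> nat set" where
  "smaller_outside H B = {i\<in>H - B. \<exists>u\<in>B. i < u}"

lemma selects_smaller_outside:
  assumes "S \<subseteq> H"
  shows "selects d (smaller_outside H) S B \<longleftrightarrow>
     B \<subseteq> S \<and> card B = d \<and> (\<forall>t\<in>S - B. \<forall>u\<in>B. u < t)"
proof -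
  have "smaller_outside H B \<inter> S = {} \<longleftrightarrow> (\<forall>t\<in>S - B. \<forall>u\<in>B. \<not> t < u)"
    using assms by (auto simp: smaller_outside_def)
  also have "\<dots> \<longleftrightarrow> (\<forall>t\<in>S - B. \<forall>u\<in>B. u < t)"
    by (metis DiffD2 linorder_neqE_nat order_less_asym)
  finally show ?thesis by (auto simp: selects_def)
qed

lemma basis_system_smaller_outside:
  assumes H: "finite H"
  shows "basis_system H d (smaller_outside H)"
  unfolding basis_system_def
proof (intro conjI allI impI)
  fix S assume S: "S \<subseteq> H" "d \<le> card S"
  have fS: "finite S" using S H finite_subset by blast
  obtain B where B: "B \<subseteq> S" "card B = d" "\<forall>t\<in>S - B. \<forall>u\<in>B. u < t"
    using initial_segment_exists[OF S(2) fS] by auto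
  show "\<exists>!B. selects d (smaller_outside H) S B"
    unfolding selects_smaller_outside[OF S(1)]
  proof (rule ex1I[of _ B])
    fix B' assume B': "B' \<subseteq> S \<and> card B' = d \<and> (\<forall>t\<in>S - B'. \<forall>u\<in>B'. u < t)"
    show "B' = B"
      by (rule initial_segment_unique[of _ S]) (use B B' fS in \<open>auto intro: finite_subset\<close>)
  qed (use B in auto)
qed (auto simp: smaller_outside_def)

text \<open>The levels of \<open>V\<close> agree with those of the model, so the count can be done
  there. If \<open>S\<close> has \<open>d\<close> elements below \<open>k + d - 1\<close>, then its
  \<open>d\<close> smallest elements all lie there and leave at most \<open>k - 1\<close> smaller
  indices outside; hence \<open>k\<close> violators force fewer than \<open>d\<close> such
  elements.\<close>

lemma card_many_violators_le:
  assumes V: "basis_system {..<K} d V" and dN: "d \<le> N" and NK: "N \<le> K" and k: "1 \<le> k"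
  shows "card {S. S \<subseteq> {..<K} \<and> card S = N \<and> (\<exists>B. selects d V S B \<and> k \<le> card (V B))}
    \<le> card {S. S \<subseteq> {..<K} \<and> card S = N \<and> card (S \<inter> {..<k + d - 1}) < d}"
proof -
  let ?H = "{..<K}" and ?W = "smaller_outside {..<K}"
  have W: "basis_system ?H d ?W" by (rule basis_system_smaller_outside) simp
  have "card {S. S \<subseteq> ?H \<and> card S = N \<and> (\<exists>B. selects d V S B \<and> k \<le> card (V B))} =
     card {S. S \<subseteq> ?H \<and> card S = N \<and> (\<exists>B. selects d ?W S B \<and> k \<le> card (?W B))}"
    unfolding card_selects[OF finite_lessThan V dN] card_selects[OF finite_lessThan W dN]
    using level_unique[OF finite_lessThan V W] dN NK by (intro sum.cong) auto
  also have "\<dots> \<le> card {S. S \<subseteq> ?H \<and> card S = N \<and> card (S \<inter> {..<k + d - 1}) < d}"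
  proof (rule card_mono)
    show "{S. S \<subseteq> ?H \<and> card S = N \<and> (\<exists>B. selects d ?W S B \<and> k \<le> card (?W B))}
        \<subseteq> {S. S \<subseteq> ?H \<and> card S = N \<and> card (S \<inter> {..<k + d - 1}) < d}"
    proof safe
      fix S B assume S: "S \<subseteq> ?H" and sel: "selects d ?W S B" and kB: "k \<le> card (?W B)"
      let ?L = "{..<k + d - 1}"
      have B: "B \<subseteq> S" "card B = d" "\<forall>t\<in>S - B. \<forall>u\<in>B. u < t"
        using sel by (auto simp: selects_smaller_outside[OF S])
      have fB: "finite B" using B(1) S by (auto intro: finite_subset[of B "{..<K}"])
      show "card (S \<inter> ?L) < d"
      proof (rule ccontr)
        assume ge: "\<not> card (S \<inter> ?L) < d"
        have BL: "B \<subseteq> ?L"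
        proof
          fix u assume u: "u \<in> B"
          show "u \<in> ?L"
          proof (rule ccontr)
            assume nu: "u \<notin> ?L"
            have "t \<in> B" if "t \<in> S" "t \<in> ?L" for t
            proof (rule ccontr)
              assume "t \<notin> B"
              then have "u < t" using B(3) that u by blast
              then show False using nu that by simp
            qed
            then have "insert u (S \<inter> ?L) \<subseteq> B" using u by blast
            then have "card (insert u (S \<inter> ?L)) \<le> card B" by (rule card_mono[OF fB])
            then have "card (insert u (S \<inter> ?L)) \<le> d" using B(2) by simp
            then show False using nu ge by simp
          qed
        qed
        have "?W B \<subseteq> ?L - B" using BL by (auto simp: smaller_outside_def)
        then have "card (?W B) \<le> card (?L - B)" by (intro card_mono) auto
        also have "\<dots> = (k + d - 1) - d" using BL B(2) fB by (simp add: card_Diff_subset)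
        finally show False using kB k by simp
      qed
    qed
  qed simp
  finally show ?thesis .
qed

lemma card_few_small_le:
  assumes "L \<le> K"
  shows "card {S. S \<subseteq> {..<K} \<and> card S = N \<and> card (S \<inter> {..<L}) < d}
    \<le> (\<Sum>i<d. (L choose i) * ((K - L) choose (N - i)))"
proof -
  define F where "F i = {S. S \<subseteq> {..<K} \<and> card S = N \<and> card (S \<inter> {..<L}) = i}" for i
  have "{S. S \<subseteq> {..<K} \<and> card S = N \<and> card (S \<inter> {..<L}) < d} = (\<Union>i<d. F i)"
    by (auto simp: F_def)
  also have "card \<dots> \<le> (\<Sum>i<d. card (F i))" by (rule card_UN_le) simp
  also have "\<dots> \<le> (\<Sum>i<d. (L choose i) * ((K - L) choose (N - i)))"
  proof (rule sum_mono)
    fix i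
    let ?T = "{T. T \<subseteq> {..<L} \<and> card T = i} \<times> {T. T \<subseteq> {L..<K} \<and> card T = N - i}"
    have "card (F i) \<le> card ?T"
    proof (rule card_inj_on_le[where f = "\<lambda>S. (S \<inter> {..<L}, S - {..<L})"])
      show "inj_on (\<lambda>S. (S \<inter> {..<L}, S - {..<L})) (F i)"
        by (rule inj_onI) blast
      show "(\<lambda>S. (S \<inter> {..<L}, S - {..<L})) ` F i \<subseteq> ?T"
      proof safe
        fix S assume S: "S \<in> F i"
        then have "finite S" using finite_subset by (auto simp: F_def)
        then show "card (S - {..<L}) = N - i" using S by (simp add: F_def card_Diff_subset_Int)
      qed (auto simp: F_def)
    qed simp
    also have "\<dots> = (L choose i) * ((K - L) choose (N - i))"
      by (simp add: card_cartesian_product n_subsets)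
    finally show "card (F i) \<le> (L choose i) * ((K - L) choose (N - i))" .
  qed
  finally show ?thesis .
qed

section \<open>Nearest point programs and their bases\<close>

text \<open>Distance to a point serves as the objective because every family of these constraints,
  including the empty one, then has exactly one optimum, which a linear objective need not
  give.\<close>

locale nearest_point_program =
  fixes H :: "nat set" and C :: "nat \<Rightarrow> 'a::euclidean_space set" and p :: 'a
  assumes finite_H: "finite H"
    and closed_C: "\<And>h. h \<in> H \<Longrightarrow> closed (C h)"
    and convex_C: "\<And>h. h \<in> H \<Longrightarrow> convex (C h)"
    and Inter_C: "(\<Inter>h\<in>H. C h) \<noteq> {}"
begin

definition region :: "nat set \<Rightarrow> 'a set" where "region S = (\<Inter>h\<in>S. C h)"

definition opt :: "nat set \<Rightarrow> 'a" where "opt S = closest_point (region S) p"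

lemma region_antimono: "A \<subseteq> S \<Longrightarrow> region S \<subseteq> region A"
  by (auto simp: region_def)

lemma region_props:
  assumes "S \<subseteq> H"
  shows "closed (region S)" "convex (region S)" "region S \<noteq> {}"
proof -
  show "closed (region S)" "convex (region S)"
    using assms closed_C convex_C unfolding region_def by (auto intro!: closed_INT convex_INT)
  have "region H \<subseteq> region S" using assms by (rule region_antimono)
  then show "region S \<noteq> {}" using Inter_C by (auto simp: region_def)
qed

lemma opt_in: "S \<subseteq> H \<Longrightarrow> opt S \<in> region S"
  unfolding opt_def by (intro closest_point_in_set region_props)

lemma opt_le: "S \<subseteq> H \<Longrightarrow> z \<in> region S \<Longrightarrow> dist p (opt S) \<le> dist p z"
  unfolding opt_def by (intro closest_point_le region_props)

lemma opt_eqI: "S \<subseteq> H \<Longrightarrow> z \<in> region S \<Longrightarrow> dist p z \<le> dist p (opt S) \<Longrightarrow> z = opt S"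
  using closest_point_lt[of "region S" z p] region_props[of S] by (fastforce simp: opt_def)

lemma opt_extend:
  assumes "A \<subseteq> S" "S \<subseteq> H" "opt A \<in> region S"
  shows "opt S = opt A"
  using opt_eqI[of S "opt A"] opt_le[of A "opt S"] opt_in[of S] region_antimono[of A S] assms
  by auto

lemma opt_between:
  assumes "A \<subseteq> T" "T \<subseteq> S" "S \<subseteq> H" "opt A = opt S"
  shows "opt T = opt S"
  using opt_extend[of A T] opt_in[of S] region_antimono[of T S] assms by auto

text \<open>If dropping \<open>h\<close> gave a strictly nearer optimum, a short step from
  \<open>opt A\<close> towards it would stay in \<open>C h\<close>, because \<open>opt A\<close> is
  interior, and in the other constraints by convexity, and it would end nearer to \<open>p\<close>
  than \<open>opt A\<close>.\<close>

lemma opt_remove_inactive: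
  assumes A: "A \<subseteq> H" "h \<in> A" "opt A \<in> interior (C h)"
  shows "opt (A - {h}) = opt A"
proof (rule ccontr)
  assume ne: "opt (A - {h}) \<noteq> opt A"
  define z where "z = opt (A - {h})"
  have AH: "A - {h} \<subseteq> H" using A by auto
  have zA: "z \<in> region (A - {h})" and yA: "opt A \<in> region (A - {h})"
    using opt_in[OF AH] opt_in[OF A(1)] region_antimono[of "A - {h}" A] by (auto simp: z_def)
  have lt: "dist p z < dist p (opt A)"
    using opt_eqI[OF AH yA] ne by (fastforce simp: z_def)
  have "((\<lambda>u. opt A + u *\<^sub>R (z - opt A)) \<longlongrightarrow> opt A + 0 *\<^sub>R (z - opt A)) (at_right 0)"
    by (intro tendsto_intros)
  then have "\<forall>\<^sub>F u in at_right 0. opt A + u *\<^sub>R (z - opt A) \<in> interior (C h)"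
    using A(3) by (intro topological_tendstoD) auto
  moreover have "\<forall>\<^sub>F u in at_right 0. u \<in> {0<..<1::real}"
    by (rule eventually_at_right_field[THEN iffD2]) (auto intro!: exI[of _ 1])
  ultimately have "\<forall>\<^sub>F u in at_right (0::real). u \<in> {0<..<1} \<and> opt A + u *\<^sub>R (z - opt A) \<in> interior (C h)"
    by eventually_elim auto
  then obtain u :: real where u: "0 < u" "u < 1" "opt A + u *\<^sub>R (z - opt A) \<in> interior (C h)"
    using eventually_happens[of _ "at_right (0::real)"] by (auto simp: trivial_limit_at_right_real)
  define w where "w = opt A + u *\<^sub>R (z - opt A)"
  have w: "w = (1 - u) *\<^sub>R opt A + u *\<^sub>R z" by (simp add: w_def algebra_simps)
  have "w \<in> region (A - {h})"
    unfolding w using region_props(2)[OF AH] yA zA u by (intro convexD) auto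
  moreover have "w \<in> C h" using u(3) interior_subset by (auto simp: w_def)
  ultimately have "w \<in> region A" by (auto simp: region_def)
  then have "dist p (opt A) \<le> dist p w" by (rule opt_le[OF A(1)])
  also have "p - w = (1 - u) *\<^sub>R (p - opt A) + u *\<^sub>R (p - z)" by (simp add: w algebra_simps)
  then have "dist p w \<le> (1 - u) * dist p (opt A) + u * dist p z"
    using norm_triangle_ineq[of "(1 - u) *\<^sub>R (p - opt A)" "u *\<^sub>R (p - z)"] u by (simp add: dist_norm)
  also have "\<dots> < (1 - u) * dist p (opt A) + u * dist p (opt A)" using lt u by simp
  finally show False by (simp add: algebra_simps)
qed

text \<open>Helly's theorem is applied to the constraints together with the open ball of points
  strictly better than the optimum.\<close>
lemma helly_basis:
  assumes S: "S \<subseteq> H"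
  shows "\<exists>A\<subseteq>S. card A \<le> DIM('a) \<and> opt A = opt S"
proof -
  define D where "D = ball p (dist p (opt S))"
  have yS: "opt S \<in> region S" using S by (rule opt_in)
  have fS: "finite S" by (rule finite_subset[OF S finite_H])
  have "\<exists>A\<subseteq>S. card A \<le> DIM('a) \<and> region A \<inter> D = {}"
  proof -
    have DC: "D \<notin> C ` S" using yS by (auto simp: region_def D_def)
    have emp: "\<Inter>(insert D (C ` S)) = {}"
      using opt_le[OF S] by (fastforce simp: D_def region_def)
    \<comment> \<open>Helly's theorem needs at least \<open>DIM('a) + 1\<close> sets; with fewer,
      all constraint sets are kept. Otherwise \<open>D\<close> must belong to the subfamily with
      empty intersection, because the constraints share \<open>opt S\<close>, and deleting it leaves
      \<open>DIM('a)\<close> sets.\<close>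
    obtain t where t: "t \<subseteq> C ` S" "card t \<le> DIM('a)" "\<Inter>t \<inter> D = {}"
    proof (cases "DIM('a) + 1 \<le> card (insert D (C ` S))")
      case False
      then have "card (C ` S) \<le> DIM('a)" using fS DC by simp
      moreover have "\<Inter>(C ` S) \<inter> D = {}" using emp by (simp add: Int_commute)
      ultimately show ?thesis using that[OF subset_refl] by simp
    next
      case True
      have "\<exists>t. t \<subseteq> insert D (C ` S) \<and> card t = DIM('a) + 1 \<and> \<Inter>t = {}"
      proof (rule ccontr)
        assume none: "\<nexists>t. t \<subseteq> insert D (C ` S) \<and> card t = DIM('a) + 1 \<and> \<Inter>t = {}"
        have "\<Inter>(insert D (C ` S)) \<noteq> {}"
        proof (rule Helly[OF True])
          have "convex (C h)" if "h \<in> S" for h using convex_C S that by blast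
          then show "\<forall>s\<in>insert D (C ` S). convex s" by (simp add: D_def)
          fix t assume "t \<subseteq> insert D (C ` S)" "card t = DIM('a) + 1"
          then show "\<Inter>t \<noteq> {}" using none by blast
        qed
        then show False using emp by simp
      qed
      then obtain t where t: "t \<subseteq> insert D (C ` S)" "card t = DIM('a) + 1" "\<Inter>t = {}" by blast
      have "D \<in> t"
      proof (rule ccontr)
        assume "D \<notin> t"
        then have "t \<subseteq> C ` S" using t(1) by blast
        then have "opt S \<in> \<Inter>t" using yS unfolding region_def by blast
        then show False using t(3) by simp
      qed
      show ?thesis
      proof (rule that[of "t - {D}"])
        show "t - {D} \<subseteq> C ` S" "\<Inter>(t - {D}) \<inter> D = {}" using t \<open>D \<in> t\<close> by blast+
        show "card (t - {D}) \<le> DIM('a)" using t(2) \<open>D \<in> t\<close> by (simp add: card_Diff_singleton)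
      qed
    qed
    \<comment> \<open>Distinct indices may carry the same set, so one index per set is chosen to
      turn a bound on the number of sets into one on the number of indices.\<close>
    obtain A where A: "A \<subseteq> S" "t = C ` A" "inj_on C A"
      using t(1) unfolding subset_image_inj by blast
    have "card A \<le> DIM('a)" using t(2) A by (simp add: card_image)
    moreover have "region A \<inter> D = {}" using t(3) A(2) by (simp add: region_def)
    ultimately show ?thesis using A(1) by blast
  qed
  then obtain A where A: "A \<subseteq> S" "card A \<le> DIM('a)" "region A \<inter> D = {}" by blast
  have AH: "A \<subseteq> H" using A(1) S by (rule subset_trans)
  have "opt A \<notin> D" using opt_in[OF AH] A(3) by blast
  then have "opt S = opt A"
    using yS region_antimono[OF A(1)] by (intro opt_eqI[OF AH]) (auto simp: D_def)
  then show ?thesis using A by (intro exI[of _ A]) simp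
qed

section \<open>Minimal bases and what makes them unique\<close>

definition minimal :: "nat set \<Rightarrow> bool" where
  "minimal A \<longleftrightarrow> (\<forall>a\<in>A. opt (A - {a}) \<noteq> opt A)"

lemma minimal_basis_exists:
  assumes S: "S \<subseteq> H"
  shows "\<exists>A\<subseteq>S. minimal A \<and> card A \<le> DIM('a) \<and> opt A = opt S"
proof -
  define Q where "Q n \<longleftrightarrow> (\<exists>A\<subseteq>S. card A = n \<and> opt A = opt S)" for n
  obtain A0 where A0: "A0 \<subseteq> S" "card A0 \<le> DIM('a)" "opt A0 = opt S"
    using helly_basis[OF S] by auto
  then have Q0: "Q (card A0)" by (auto simp: Q_def)
  then have "Q (LEAST n. Q n)" by (rule LeastI)
  then obtain A where A: "A \<subseteq> S" "card A = (LEAST n. Q n)" "opt A = opt S" by (auto simp: Q_def)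
  have fA: "finite A" using A(1) S by (auto intro: finite_subset[OF _ finite_H])
  have "minimal A"
    unfolding minimal_def
  proof (intro ballI notI)
    fix a assume a: "a \<in> A" "opt (A - {a}) = opt A"
    then have "Q (card (A - {a}))" unfolding Q_def using A by (intro exI[of _ "A - {a}"]) auto
    then have "(LEAST n. Q n) \<le> card (A - {a})" by (rule Least_le)
    also have "\<dots> < card A" using a fA by (intro psubset_card_mono) auto
    finally show False using A by simp
  qed
  moreover have "card A \<le> DIM('a)" using Least_le[of Q, OF Q0] A A0 by simp
  ultimately show ?thesis using A(1,3) by blast
qed

end

text \<open>This excludes degeneracy: an optimum on the boundary of a constraint outside
  \<open>A\<close> might be held in place by that constraint just as well, and minimal bases could
  cease to be unique.\<close>

locale generic_nearest_point_program = nearest_point_program +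
  assumes generic: "\<And>A h. A \<subseteq> H \<Longrightarrow> h \<in> H - A \<Longrightarrow> opt A \<in> C h \<Longrightarrow> opt A \<in> interior (C h)"
begin

text \<open>By genericity, an index of \<open>A'\<close> missing from \<open>A\<close> has the
  common optimum in the interior of its constraint, so it could be dropped from \<open>A'\<close>,
  against minimality. Applied in both directions, this makes the minimal basis a function of the
  optimum.\<close>

lemma minimal_subset:
  assumes "A \<subseteq> H" "A' \<subseteq> H" "minimal A'" "opt A = opt A'"
  shows "A' \<subseteq> A"
proof (rule ccontr)
  assume "\<not> A' \<subseteq> A"
  then obtain h where h: "h \<in> A'" "h \<notin> A" by auto
  then have "opt A \<in> C h" using opt_in[OF assms(2)] assms(4) by (auto simp: region_def)
  moreover have "h \<in> H - A" using h assms(2) by blast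
  ultimately have "opt A' \<in> interior (C h)" using generic[OF assms(1)] assms(4) by simp
  then show False using opt_remove_inactive[OF assms(2) h(1)] assms(3) h(1) unfolding minimal_def by blast
qed

definition basis :: "nat set \<Rightarrow> nat set" where
  "basis S = (SOME A. A \<subseteq> S \<and> minimal A \<and> card A \<le> DIM('a) \<and> opt A = opt S)"

lemma basis:
  assumes "S \<subseteq> H"
  shows "basis S \<subseteq> S" "minimal (basis S)" "card (basis S) \<le> DIM('a)" "opt (basis S) = opt S"
  using someI_ex[OF minimal_basis_exists[OF assms]] unfolding basis_def by blast+

lemma basis_cong:
  assumes "S \<subseteq> H" "T \<subseteq> H" "opt S = opt T"
  shows "basis S = basis T"
proof
  have "basis S \<subseteq> H" "basis T \<subseteq> H" using basis(1)[OF assms(1)] basis(1)[OF assms(2)] assms by blast+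
  then show "basis S \<subseteq> basis T" "basis T \<subseteq> basis S"
    using basis[OF assms(1)] basis[OF assms(2)] assms(3) by (simp_all add: minimal_subset)
qed

text \<open>A basis may have fewer than \<open>DIM('a)\<close> elements; it is filled up with the smallest remaining
  indices, and a smaller index then counts as a violator.\<close>
definition blockers :: "nat set \<Rightarrow> nat set" where
  "blockers B = {h\<in>H - B. opt B \<notin> C h \<or> (\<exists>u\<in>B - basis B. h < u)}"

text \<open>The optimum of \<open>B\<close> is that of \<open>S\<close> exactly when it satisfies
  the remaining constraints of \<open>S\<close>; this accounts for the first alternative in
  \<open>blockers\<close>. The second one makes the padding \<open>B - basis B\<close> precede
  everything left out.\<close>

lemma selects_blockers:
  assumes "S \<subseteq> H"
  shows "selects d blockers S B \<longleftrightarrow>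
    card B = d \<and> B \<subseteq> S \<and> opt B = opt S \<and> (\<forall>t\<in>S - B. \<forall>u\<in>B - basis B. u < t)"
proof (cases "B \<subseteq> S")
  case True
  then have BH: "B \<subseteq> H" using assms by auto
  have "opt B = opt S \<longleftrightarrow> opt B \<in> region S"
    using opt_in[OF assms] opt_extend[OF True assms] by auto
  also have "\<dots> \<longleftrightarrow> (\<forall>h\<in>S - B. opt B \<in> C h)"
    using opt_in[OF BH] True by (auto simp: region_def)
  finally have 1: "opt B = opt S \<longleftrightarrow> (\<forall>h\<in>S - B. opt B \<in> C h)" .
  have "(\<forall>t\<in>S - B. \<forall>u\<in>B - basis B. u < t) \<longleftrightarrow> (\<forall>t\<in>S - B. \<forall>u\<in>B - basis B. \<not> t < u)"
    
  proof (intro ball_cong refl)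
    fix t u assume "t \<in> S - B" "u \<in> B - basis B"
    then have "t \<noteq> u" by auto
    then show "u < t \<longleftrightarrow> \<not> t < u" by auto
  qed
  moreover have "blockers B \<inter> S = {} \<longleftrightarrow>
      (\<forall>h\<in>S - B. opt B \<in> C h) \<and> (\<forall>t\<in>S - B. \<forall>u\<in>B - basis B. \<not> t < u)"
    using assms by (auto simp: blockers_def)
  ultimately show ?thesis using 1 True by (simp add: selects_def)
qed (auto simp: selects_def)

text \<open>Every selected set has the same optimum as \<open>S\<close> and therefore contains the
  minimal basis \<open>A\<close> of \<open>S\<close>; its other \<open>DIM('a) - card A\<close>
  elements are forced to be the smallest ones of \<open>S - A\<close>. Existence holds because
  padding inside \<open>S\<close> does not move the optimum.\<close>

lemma basis_system_blockers: "basis_system H DIM('a) blockers"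
  unfolding basis_system_def
proof (intro conjI allI impI)
  fix S assume S: "S \<subseteq> H" "DIM('a) \<le> card S"
  have fS: "finite S" by (rule finite_subset[OF S(1) finite_H])
  define A where "A = basis S"
  have A: "A \<subseteq> S" "card A \<le> DIM('a)" "opt A = opt S" using basis[OF S(1)] by (auto simp: A_def)
  have fA: "finite A" by (rule finite_subset[OF A(1) fS])
  define e where "e = DIM('a) - card A"
  have "e \<le> card (S - A)" using S(2) A fA by (simp add: e_def card_Diff_subset)
  then obtain E where E: "E \<subseteq> S - A" "card E = e" "\<forall>t\<in>S - A - E. \<forall>u\<in>E. u < t"
    using initial_segment_exists[of e "S - A"] fS by auto
  have fE: "finite E" using E(1) fS by (meson finite_Diff finite_subset)
  define B where "B = A \<union> E"
  have BS: "B \<subseteq> S" using A E by (auto simp: B_def)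
  have optB: "opt B = opt S" using opt_between[of A B S] A BS S by (auto simp: B_def)
  have basB: "basis B = A" using basis_cong[of B S] optB BS S by (auto simp: A_def)
  have "card B = card A + card E" unfolding B_def using fA fE E(1) by (intro card_Un_disjoint) auto
  then have cB: "card B = DIM('a)" using E(2) A(2) by (simp add: e_def)
  have "B - basis B = E" "S - B = S - A - E" using E(1) basB by (auto simp: B_def)
  then have sel: "selects DIM('a) blockers S B"
    using selects_blockers[OF S(1)] cB BS optB E(3) by simp
  show "\<exists>!B. selects DIM('a) blockers S B"
  proof (rule ex1I)
    show "selects DIM('a) blockers S B" by (rule sel)
  next
    fix B' assume "selects DIM('a) blockers S B'"
    then have B': "card B' = DIM('a)" "B' \<subseteq> S" "opt B' = opt S"
      "\<forall>t\<in>S - B'. \<forall>u\<in>B' - basis B'. u < t"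
      using selects_blockers[OF S(1)] by auto
    have bas': "basis B' = A" using basis_cong[of B' S] B' S by (auto simp: A_def)
    then have AB': "A \<subseteq> B'" using basis(1)[of B'] B' S by auto
    have fB': "finite B'" by (rule finite_subset[OF B'(2) fS])
    have "B' - A = E"
    proof (rule initial_segment_unique[of _ "S - A"])
      have "S - A - (B' - A) = S - B'" using AB' by auto
      then show "\<forall>t\<in>S - A - (B' - A). \<forall>u\<in>B' - A. u < t" using B'(4) bas' by simp
      show "card (B' - A) = card E" using AB' fA B' E by (simp add: card_Diff_subset e_def)
    qed (use B' E fB' fE in auto)
    then show "B' = B" using AB' unfolding B_def by blast
  qed
qed (auto simp: blockers_def)

text \<open>Padding may add blockers that are no violators. One inclusion is enough, since the
  number of subsets with many violators only has to be bounded from above.\<close>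

lemma violators_subset_blockers:
  assumes "S \<subseteq> H" "selects d blockers S B"
  shows "{h\<in>H. opt S \<notin> C h} \<subseteq> blockers B"
proof -
  have B: "B \<subseteq> S" "opt B = opt S" using assms selects_blockers[OF assms(1)] by auto
  have "opt S \<in> C h" if "h \<in> B" for h using opt_in[OF assms(1)] B that by (auto simp: region_def)
  then show ?thesis using B by (auto simp: blockers_def)
qed

end

section \<open>Generic perturbation\<close>

lemma convex_infdist_le:
  fixes K :: "'a::euclidean_space set"
  assumes "convex K" "compact K" "K \<noteq> {}"
  shows "convex {y. infdist y K \<le> r}"
proof (rule convexI; clarify)
  fix y z and u v :: real
  assume yz: "infdist y K \<le> r" "infdist z K \<le> r" and uv: "0 \<le> u" "0 \<le> v" "u + v = 1"
  have cl: "closed K" using assms(2) by (rule compact_imp_closed)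
  obtain a where a: "a \<in> K" "infdist y K = dist y a" using infdist_attains_inf[OF cl assms(3)] by metis
  obtain b where b: "b \<in> K" "infdist z K = dist z b" using infdist_attains_inf[OF cl assms(3)] by metis
  have "u *\<^sub>R a + v *\<^sub>R b \<in> K" using assms(1) a b uv by (intro convexD) auto
  then have "infdist (u *\<^sub>R y + v *\<^sub>R z) K \<le> dist (u *\<^sub>R y + v *\<^sub>R z) (u *\<^sub>R a + v *\<^sub>R b)"
    by (rule infdist_le)
  also have "\<dots> = norm (u *\<^sub>R (y - a) + v *\<^sub>R (z - b))" by (simp add: dist_norm algebra_simps)
  also have "\<dots> \<le> u * dist y a + v * dist z b"
    using norm_triangle_ineq[of "u *\<^sub>R (y - a)" "v *\<^sub>R (z - b)"] uv by (simp add: dist_norm)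
  also have "\<dots> \<le> u * r + v * r" using a b yz uv by (intro add_mono mult_left_mono) auto
  also have "\<dots> = r" using uv by (simp flip: distrib_right)
  finally show "infdist (u *\<^sub>R y + v *\<^sub>R z) K \<le> r" .
qed

lemma closed_infdist_le: "closed {y. infdist y K \<le> r}"
  by (intro closed_Collect_le continuous_intros)

text \<open>Each forbidden relation excludes at most one value of \<open>r h\<close> once the other coordinates are
  chosen, so on a sufficiently fine grid they do not exclude all points.\<close>
lemma generic_radii:
  fixes \<phi> :: "nat set \<Rightarrow> nat \<Rightarrow> (nat \<Rightarrow> real) \<Rightarrow> real"
  assumes H: "finite H" and eta: "0 < \<eta>"
    and local: "\<And>A h r r'. (\<And>i. i \<in> A \<Longrightarrow> r i = r' i) \<Longrightarrow> \<phi> A h r = \<phi> A h r'"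
  shows "\<exists>r. (\<forall>i\<in>H. 0 < r i \<and> r i \<le> \<eta>) \<and> (\<forall>A\<subseteq>H. \<forall>h\<in>H - A. \<phi> A h r \<noteq> r h)"
proof -
  define K where "K = card H"
  \<comment> \<open>There are at most \<open>2 ^ K * K\<close> relations, and each excludes at most
    \<open>m ^ (K - 1)\<close> of the \<open>m ^ K\<close> grid points, so taking \<open>m\<close>
    larger than the number of relations leaves a point free.\<close>
  define m where "m = 2 ^ K * K + 1"
  define G where "G = H \<rightarrow>\<^sub>E {..<m}"
  define R where "R a = (\<lambda>i. \<eta> * (real (a i) + 1) / real m)" for a :: "nat \<Rightarrow> nat"
  define Z where "Z = (SIGMA A:Pow H. H - A)"
  define Bad where "Bad = (\<lambda>(A, h). {a\<in>G. \<phi> A h (R a) = R a h})"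
  have m: "0 < m" by (simp add: m_def)
  have fG: "finite G" unfolding G_def using H by (intro finite_PiE) auto
  have cG: "card G = m ^ K" unfolding G_def using H by (simp add: card_PiE K_def)
  have fZ: "finite Z" using H by (auto simp: Z_def)
  have "card Z \<le> card (Pow H \<times> H)" using H by (intro card_mono) (auto simp: Z_def)
  also have "\<dots> = 2 ^ K * K" using H by (simp add: card_Pow K_def card_cartesian_product)
  finally have cZ: "card Z < m" by (simp add: m_def)
  have cBad: "card (Bad z) \<le> m ^ (K - 1)" if z: "z \<in> Z" for z
  proof -
    obtain A h where Ah: "z = (A, h)" "A \<subseteq> H" "h \<in> H" "h \<notin> A" using z by (auto simp: Z_def)
    have "card (Bad z) \<le> card ((H - {h}) \<rightarrow>\<^sub>E {..<m})"
    proof (rule card_inj_on_le[where f = "\<lambda>a. restrict a (H - {h})"])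
      show "inj_on (\<lambda>a. restrict a (H - {h})) (Bad z)"
      proof (rule inj_onI)
        fix a b assume ab: "a \<in> Bad z" "b \<in> Bad z" "restrict a (H - {h}) = restrict b (H - {h})"
        have eq: "a i = b i" if "i \<in> H - {h}" for i using fun_cong[OF ab(3), of i] that by simp
        \<comment> \<open>\<open>h\<close> is not in \<open>A\<close>, so \<open>\<phi> A h\<close>
          does not see the one coordinate in which \<open>a\<close> and \<open>b\<close> may
          differ.\<close>
        have "\<phi> A h (R a) = \<phi> A h (R b)"
          by (rule local) (use eq Ah in \<open>auto simp: R_def\<close>)
        then have "R a h = R b h" using ab by (auto simp: Bad_def Ah)
        then have "a h = b h" using eta m by (simp add: R_def)
        then have "a i = b i" if "i \<in> H" for i using eq that by (cases "i = h") auto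
        then show "a = b" using ab by (intro PiE_ext[of a H _ b]) (auto simp: Bad_def Ah G_def)
      qed
      show "(\<lambda>a. restrict a (H - {h})) ` Bad z \<subseteq> (H - {h}) \<rightarrow>\<^sub>E {..<m}"
      proof (rule image_subsetI)
        fix a assume "a \<in> Bad z"
        then have "a \<in> H \<rightarrow>\<^sub>E {..<m}" by (simp add: Bad_def Ah G_def)
        then have "\<forall>i\<in>H - {h}. a i \<in> {..<m}" by blast
        then show "restrict a (H - {h}) \<in> (H - {h}) \<rightarrow>\<^sub>E {..<m}" by (simp add: restrict_PiE_iff)
      qed
    qed (use H in \<open>auto intro: finite_PiE\<close>)
    also have "\<dots> = m ^ (K - 1)" using H Ah by (simp add: card_PiE K_def)
    finally show ?thesis .
  qed
  have "card (\<Union>z\<in>Z. Bad z) < card G"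
  proof (cases "K = 0")
    case True
    then have "Z = {}" using H by (auto simp: Z_def K_def)
    then show ?thesis using cG True by simp
  next
    case False
    have "card (\<Union>z\<in>Z. Bad z) \<le> (\<Sum>z\<in>Z. card (Bad z))" by (rule card_UN_le[OF fZ])
    also have "\<dots> \<le> card Z * m ^ (K - 1)" using sum_bounded_above[of Z "\<lambda>z. card (Bad z)"] cBad by simp
    also have "\<dots> < m * m ^ (K - 1)" using cZ m by simp
    also have "\<dots> = card G" using False cG by (simp flip: power_Suc)
    finally show ?thesis .
  qed
  moreover have "(\<Union>z\<in>Z. Bad z) \<subseteq> G" by (auto simp: Bad_def)
  then have "finite (\<Union>z\<in>Z. Bad z)" using fG by (rule finite_subset)
  ultimately have "\<not> G \<subseteq> (\<Union>z\<in>Z. Bad z)" using card_mono by (metis not_le)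
  then obtain a where a: "a \<in> G" "a \<notin> (\<Union>z\<in>Z. Bad z)" by blast
  show ?thesis
  proof (intro exI[of _ "R a"] conjI ballI allI impI)
    fix i assume "i \<in> H"
    then have "a i < m" using a by (auto simp: G_def)
    then have "(real (a i) + 1) / real m \<le> 1" using m by (simp add: field_simps)
    then have "\<eta> * ((real (a i) + 1) / real m) \<le> \<eta> * 1" using eta by (intro mult_left_mono) auto
    then show "R a i \<le> \<eta>" by (simp add: R_def)
    show "0 < R a i" using eta m by (simp add: R_def)
  next
    fix A h assume "A \<subseteq> H" "h \<in> H - A"
    then have "(A, h) \<in> Z" by (auto simp: Z_def)
    then show "\<phi> A h (R a) \<noteq> R a h" using a by (auto simp: Bad_def)
  qed
qed

text \<open>Minimising \<open>c \<bullet> x\<close> is approximated by projecting the far away point \<open>- c / \<eta>\<close>.\<close>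
lemma perturbed_optimum_violates:
  fixes K :: "nat \<Rightarrow> 'a::euclidean_space set"
  assumes S: "S \<noteq> {}" "h \<notin> S" and K: "\<And>i. i \<in> insert h S \<Longrightarrow> compact (K i) \<and> K i \<noteq> {}"
    and x: "\<And>i. i \<in> S \<Longrightarrow> x \<in> K i" "x \<notin> K h"
    and uniq: "\<And>z. (\<And>i. i \<in> S \<Longrightarrow> z \<in> K i) \<Longrightarrow> c \<bullet> z \<le> c \<bullet> x \<Longrightarrow> z = x"
  shows "\<forall>\<^sub>F \<eta> in at_right 0. \<forall>r. (\<forall>i\<in>insert h S. 0 < r i \<and> r i \<le> \<eta>) \<longrightarrow>
     r h < infdist (closest_point (\<Inter>i\<in>S. {y. infdist y (K i) \<le> r i}) (- c /\<^sub>R \<eta>)) (K h)"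
proof (rule ccontr)
  \<comment> \<open>Otherwise there are \<open>\<eta> n\<close> tending to 0 and radii for which the
    projections nearly satisfy \<open>K h\<close> as well. A limit point of them lies in
    \<open>K h\<close> and in every \<open>K i\<close> and costs at most
    \<open>c \<bullet> x\<close>, so by uniqueness it equals \<open>x\<close>, which is not in
    \<open>K h\<close>.\<close>
  define q where "q r \<eta> = closest_point (\<Inter>i\<in>S. {y. infdist y (K i) \<le> r i}) (- c /\<^sub>R \<eta>)" for r \<eta>
  define good where "good \<eta> r \<longleftrightarrow> ((\<forall>i\<in>insert h S. 0 < r i \<and> r i \<le> \<eta>) \<longrightarrow> r h < infdist (q r \<eta>) (K h))" for \<eta> r
  assume "\<not> ?thesis"
  then have "\<not> (\<forall>\<^sub>F \<eta> in at_right 0. \<forall>r. good \<eta> r)" by (simp only: good_def q_def not_False_eq_True)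
  then have bad: "\<forall>b>0. \<exists>\<eta>>0. \<eta> < b \<and> (\<exists>r. \<not> good \<eta> r)"
    by (simp add: eventually_at_right_field)
  have "\<exists>\<eta> r. 0 < \<eta> \<and> \<eta> < inverse (real (Suc n)) \<and> \<not> good \<eta> r" for n
    using bad[rule_format, of "inverse (real (Suc n))"] by auto
  then have "\<exists>w. \<forall>n. 0 < fst (w n) \<and> fst (w n) < inverse (real (Suc n)) \<and> \<not> good (fst (w n)) (snd (w n))"
    by (intro choice) simp
  then obtain w where w: "\<And>n. 0 < fst (w n)" "\<And>n. fst (w n) < inverse (real (Suc n))"
      "\<And>n. \<not> good (fst (w n)) (snd (w n))"
    by blast
  define \<eta> where "\<eta> = fst \<circ> w"
  define r where "r = snd \<circ> w"
  have eta: "0 < \<eta> n" "\<eta> n < inverse (real (Suc n))" for n using w by (auto simp: \<eta>_def)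
  have ng: "\<not> good (\<eta> n) (r n)" for n using w by (auto simp: \<eta>_def r_def)
  have r: "0 < r n i \<and> r n i \<le> \<eta> n" if "i \<in> insert h S" for n i
    using ng[of n] that unfolding good_def by blast
  have le: "infdist (q (r n) (\<eta> n)) (K h) \<le> r n h" for n
    using ng[of n] unfolding good_def by (simp add: not_less)
  define Q where "Q n = (\<Inter>i\<in>S. {y. infdist y (K i) \<le> r n i})" for n
  define y where "y n = closest_point (Q n) (- c /\<^sub>R \<eta> n)" for n
  have xQ: "x \<in> Q n" for n using x(1) r by (auto simp: Q_def less_imp_le)
  have clQ: "closed (Q n)" for n unfolding Q_def by (intro closed_INT ballI closed_infdist_le)
  have yQ: "y n \<in> Q n" for n unfolding y_def using clQ xQ by (intro closest_point_in_set) auto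
  have small: "infdist (y n) (K i) \<le> \<eta> n" if "i \<in> insert h S" for n i
  proof (cases "i = h")
    case True
    then show ?thesis using le[of n] r[of h n] by (simp add: y_def Q_def q_def)
  next
    case False
    then have "infdist (y n) (K i) \<le> r n i" using yQ[of n] that by (auto simp: Q_def)
    then show ?thesis using r[OF that, of n] by simp
  qed
  have eta0: "\<eta> \<longlonglongrightarrow> 0"
    by (rule tendsto_sandwich[OF _ _ tendsto_const LIMSEQ_inverse_real_of_nat])
       (use eta less_imp_le in \<open>auto intro!: always_eventually\<close>)
  \<comment> \<open>A single compact constraint already confines all \<open>y n\<close> to a bounded
    set; this is where \<open>S\<close> has to be nonempty.\<close>
  obtain s where s: "s \<in> S" using S by auto
  have "compact {y. infdist y (K s) \<le> 1}" using K[of s] s by (intro compact_infdist_le) auto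
  moreover have "y n \<in> {y. infdist y (K s) \<le> 1}" for n
  proof -
    have "inverse (real (Suc n)) \<le> 1" by (simp add: field_simps)
    then show ?thesis using small[of s n] s eta(2)[of n] by simp
  qed
  ultimately obtain l \<sigma> where l: "strict_mono \<sigma>" "(y \<circ> \<sigma>) \<longlonglongrightarrow> l"
    unfolding compact_eq_seq_compact_metric seq_compact_def by metis
  have eta\<sigma>: "(\<lambda>n. \<eta> (\<sigma> n)) \<longlonglongrightarrow> 0" using LIMSEQ_subseq_LIMSEQ[OF eta0 l(1)] by (simp add: o_def)
  have y\<sigma>: "(\<lambda>n. y (\<sigma> n)) \<longlonglongrightarrow> l" using l(2) by (simp add: o_def)
  have lK: "l \<in> K i" if i: "i \<in> insert h S" for i
  proof -
    have "(\<lambda>n. infdist (y (\<sigma> n)) (K i)) \<longlonglongrightarrow> infdist l (K i)"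
      by (intro tendsto_infdist y\<sigma>)
    then have "infdist l (K i) \<le> 0"
      by (rule LIMSEQ_le[OF _ eta\<sigma>]) (use small[OF i] in auto)
    then show ?thesis
      using in_closed_iff_infdist_zero[of "K i" l] K[OF i] infdist_nonneg[of l "K i"]
      by (auto intro: compact_imp_closed)
  qed
  \<comment> \<open>Both squared distances to \<open>- c /\<^sub>R \<eta> n\<close> contain the
    squared norm of that far point. Cancelling it and dropping \<open>y n \<bullet> y n\<close>
    leaves the linear objective with an error of order \<open>\<eta> n\<close>.\<close>
  have cost: "c \<bullet> y n \<le> c \<bullet> x + \<eta> n * (x \<bullet> x) / 2" for n
  proof -
    have "dist (- c /\<^sub>R \<eta> n) (y n) \<le> dist (- c /\<^sub>R \<eta> n) x"
      unfolding y_def using clQ xQ by (intro closest_point_le) auto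
    then have "(norm (- c /\<^sub>R \<eta> n - y n))\<^sup>2 \<le> (norm (- c /\<^sub>R \<eta> n - x))\<^sup>2"
      by (intro power_mono) (auto simp: dist_norm)
    then have "y n \<bullet> y n + 2 * (c \<bullet> y n) / \<eta> n \<le> x \<bullet> x + 2 * (c \<bullet> x) / \<eta> n"
      by (simp add: power2_norm_eq_inner inner_diff inner_commute divide_inverse algebra_simps)
    moreover have "0 \<le> y n \<bullet> y n" by simp
    ultimately have "2 * (c \<bullet> y n) / \<eta> n \<le> x \<bullet> x + 2 * (c \<bullet> x) / \<eta> n" by linarith
    then show ?thesis using eta(1)[of n] by (simp add: field_simps)
  qed
  have "(\<lambda>n. c \<bullet> y (\<sigma> n)) \<longlonglongrightarrow> c \<bullet> l" by (intro tendsto_intros y\<sigma>)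
  moreover have "(\<lambda>n. c \<bullet> x + \<eta> (\<sigma> n) * (x \<bullet> x) / 2) \<longlonglongrightarrow> c \<bullet> x + 0 * (x \<bullet> x) / 2"
    by (intro tendsto_intros eta\<sigma>) simp
  ultimately have "c \<bullet> l \<le> c \<bullet> x + 0 * (x \<bullet> x) / 2" by (rule LIMSEQ_le) (use cost in auto)
  then have "l = x" using lK by (intro uniq) auto
  then show False using lK[of h] x(2) by simp
qed

text \<open>Only the finitely many optima matter, so each constraint set is first replaced by the
  polytope spanned by those optima that it contains. This makes the sets compact and changes
  neither the optima nor their violators.\<close>
lemma generic_perturbation:
  fixes F :: "nat \<Rightarrow> 'a::euclidean_space set" and x :: "nat set \<Rightarrow> 'a"
  assumes H: "finite H" and F: "\<And>h. h \<in> H \<Longrightarrow> convex (F h)"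
    and x_in: "\<And>S h. S \<subseteq> H \<Longrightarrow> h \<in> S \<Longrightarrow> x S \<in> F h"
    and uniq: "\<And>S z. S \<subseteq> H \<Longrightarrow> S \<noteq> {} \<Longrightarrow> (\<And>h. h \<in> S \<Longrightarrow> z \<in> F h) \<Longrightarrow> c \<bullet> z \<le> c \<bullet> x S \<Longrightarrow> z = x S"
  shows "\<exists>C (p :: 'a). generic_nearest_point_program H C p \<and>
     (\<forall>S\<subseteq>H. S \<noteq> {} \<longrightarrow> (\<forall>h\<in>H. x S \<notin> F h \<longrightarrow> nearest_point_program.opt C p S \<notin> C h))"
proof -
  define X where "X h = x ` {S. S \<subseteq> H \<and> S \<noteq> {} \<and> x S \<in> F h}" for h
  define K where "K h = convex hull (X h)" for h
  have finX: "finite (X h)" for h using H by (auto simp: X_def)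
  have compK: "compact (K h)" for h unfolding K_def by (rule finite_imp_compact_convex_hull[OF finX])
  have convK: "convex (K h)" for h by (simp add: K_def)
  have KF: "K h \<subseteq> F h" if "h \<in> H" for h
    unfolding K_def using F[OF that] by (intro hull_minimal) (auto simp: X_def)
  have xK: "x S \<in> K h" if "S \<subseteq> H" "S \<noteq> {}" "x S \<in> F h" for S h
    unfolding K_def X_def using that by (intro hull_inc) auto
  have neK: "K h \<noteq> {}" if "h \<in> H" for h using xK[of "{h}" h] x_in[of "{h}" h] that by auto
  define Cr where "Cr r h = {y. infdist y (K h) \<le> r h}" for r :: "nat \<Rightarrow> real" and h
  define y where "y \<eta> r S = closest_point (\<Inter>h\<in>S. Cr r h) (- c /\<^sub>R \<eta>)" for \<eta> r and S :: "nat set"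
  \<comment> \<open>These are the violations that must survive the perturbation; being finitely
    many, they share one \<open>\<eta>\<close>.\<close>
  define Z where "Z = {(S, h). S \<subseteq> H \<and> S \<noteq> {} \<and> h \<in> H \<and> x S \<notin> F h}"
  have "Z \<subseteq> Pow H \<times> H" by (auto simp: Z_def)
  then have finZ: "finite Z" by (rule finite_subset) (use H in auto)
  have "\<forall>\<^sub>F \<eta> in at_right 0. \<forall>r. (\<forall>i\<in>insert h S. 0 < r i \<and> r i \<le> \<eta>) \<longrightarrow> r h < infdist (y \<eta> r S) (K h)"
    if "(S, h) \<in> Z" for S h
    unfolding y_def Cr_def
  proof (rule perturbed_optimum_violates)
    have Sh: "S \<subseteq> H" "S \<noteq> {}" "h \<in> H" "x S \<notin> F h" using that by (auto simp: Z_def)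
    show "S \<noteq> {}" by (rule Sh)
    show "h \<notin> S" using x_in[OF Sh(1)] Sh(4) by auto
    show "compact (K i) \<and> K i \<noteq> {}" if "i \<in> insert h S" for i using that Sh compK neK by auto
    show "x S \<in> K i" if "i \<in> S" for i using xK[OF Sh(1,2)] x_in[OF Sh(1) that] by simp
    show "x S \<notin> K h" using KF[OF Sh(3)] Sh(4) by auto
    show "z = x S" if "\<And>i. i \<in> S \<Longrightarrow> z \<in> K i" "c \<bullet> z \<le> c \<bullet> x S" for z
      using that KF Sh(1) by (intro uniq[OF Sh(1,2)]) auto
  qed
  then have "\<forall>\<^sub>F \<eta> in at_right (0::real). \<forall>z\<in>Z. \<forall>r. (\<forall>i\<in>insert (snd z) (fst z). 0 < r i \<and> r i \<le> \<eta>) \<longrightarrow>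
      r (snd z) < infdist (y \<eta> r (fst z)) (K (snd z))"
    using finZ by (intro eventually_ball_finite) auto
  moreover have "\<forall>\<^sub>F \<eta> in at_right (0::real). 0 < \<eta>" by (rule eventually_at_right_less)
  ultimately have "\<forall>\<^sub>F \<eta> in at_right (0::real). 0 < \<eta> \<and> (\<forall>z\<in>Z. \<forall>r. (\<forall>i\<in>insert (snd z) (fst z). 0 < r i \<and> r i \<le> \<eta>) \<longrightarrow>
      r (snd z) < infdist (y \<eta> r (fst z)) (K (snd z)))"
    by eventually_elim auto
  from eventually_happens'[OF trivial_limit_at_right_real this]
  obtain \<eta> where eta: "0 < \<eta>" and viol': "\<forall>z\<in>Z. \<forall>r. (\<forall>i\<in>insert (snd z) (fst z). 0 < r i \<and> r i \<le> \<eta>) \<longrightarrow>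
      r (snd z) < infdist (y \<eta> r (fst z)) (K (snd z))"
    by blast
  have viol: "r h < infdist (y \<eta> r S) (K h)" if "(S, h) \<in> Z" "\<forall>i\<in>insert h S. 0 < r i \<and> r i \<le> \<eta>" for S h r
    using bspec[OF viol' that(1)] that(2) by simp
  \<comment> \<open>The optimum of \<open>A\<close> can lie in \<open>Cr r h\<close> without being
    interior only if its distance from \<open>K h\<close> equals \<open>r h\<close>. That optimum
    depends on the radii in \<open>A\<close> alone, as \<open>generic_radii\<close>
    requires.\<close>
  have "\<exists>r. (\<forall>i\<in>H. 0 < r i \<and> r i \<le> \<eta>) \<and> (\<forall>A\<subseteq>H. \<forall>h\<in>H - A. infdist (y \<eta> r A) (K h) \<noteq> r h)"
  proof (rule generic_radii[OF H eta])
    fix A h and r r' :: "nat \<Rightarrow> real" assume "\<And>i. i \<in> A \<Longrightarrow> r i = r' i"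
    then show "infdist (y \<eta> r A) (K h) = infdist (y \<eta> r' A) (K h)" by (simp add: y_def Cr_def)
  qed
  then obtain r where r: "\<And>i. i \<in> H \<Longrightarrow> 0 < r i \<and> r i \<le> \<eta>"
    and gen: "\<And>A h. A \<subseteq> H \<Longrightarrow> h \<in> H - A \<Longrightarrow> infdist (y \<eta> r A) (K h) \<noteq> r h" by blast
  define p where "p = - c /\<^sub>R \<eta>"
  interpret nearest_point_program H "Cr r" p
  proof
    show "finite H" by (rule H)
    show "closed (Cr r h)" if "h \<in> H" for h unfolding Cr_def by (rule closed_infdist_le)
    show "convex (Cr r h)" if "h \<in> H" for h
      unfolding Cr_def using convK compK neK[OF that] by (rule convex_infdist_le)
    show "(\<Inter>h\<in>H. Cr r h) \<noteq> {}"
    proof (cases "H = {}")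
      case False
      have "x H \<in> Cr r h" if "h \<in> H" for h
        using xK[of H h] x_in[of H h] False that r[OF that] by (auto simp: Cr_def less_imp_le)
      then have "x H \<in> (\<Inter>h\<in>H. Cr r h)" by blast
      then show ?thesis by (metis empty_iff)
    qed simp
  qed
  have opt_y: "opt S = y \<eta> r S" for S unfolding opt_def unfolding region_def y_def p_def by (rule refl)
  have gp: "generic_nearest_point_program H (Cr r) p"
  proof
    fix A h assume A: "A \<subseteq> H" "h \<in> H - A" "opt A \<in> Cr r h"
    then have "infdist (opt A) (K h) < r h" using gen[OF A(1,2)] by (simp add: opt_y Cr_def)
    moreover have "open {z. infdist z (K h) < r h}" by (intro open_Collect_less continuous_intros)
    then have "{z. infdist z (K h) < r h} \<subseteq> interior (Cr r h)"
      by (rule interior_maximal[rotated]) (auto simp: Cr_def)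
    ultimately show "opt A \<in> interior (Cr r h)" by auto
  qed
  have "opt S \<notin> Cr r h" if "S \<subseteq> H" "S \<noteq> {}" "h \<in> H" "x S \<notin> F h" for S h
  proof -
    have "r h < infdist (y \<eta> r S) (K h)"
      by (rule viol) (use that r in \<open>auto simp: Z_def\<close>)
    then show ?thesis by (simp add: opt_y Cr_def)
  qed
  with gp show ?thesis by - (rule exI[of _ "Cr r"], rule exI[of _ p], simp)
qed

lemma card_violating_samples_le:
  fixes F :: "nat \<Rightarrow> 'a::euclidean_space set" and x :: "nat set \<Rightarrow> 'a"
  assumes F: "\<And>h. h < K \<Longrightarrow> convex (F h)"
    and x_in: "\<And>S h. S \<subseteq> {..<K} \<Longrightarrow> h \<in> S \<Longrightarrow> x S \<in> F h"
    and uniq: "\<And>S z. S \<subseteq> {..<K} \<Longrightarrow> S \<noteq> {} \<Longrightarrow> (\<And>h. h \<in> S \<Longrightarrow> z \<in> F h) \<Longrightarrow> c \<bullet> z \<le> c \<bullet> x S \<Longrightarrow> z = x S"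
    and N: "DIM('a) \<le> N" "N \<le> K" and k: "1 \<le> k" "k + DIM('a) - 1 \<le> K"
  shows "card {S. S \<subseteq> {..<K} \<and> card S = N \<and> k \<le> card {h. h < K \<and> x S \<notin> F h}}
    \<le> (\<Sum>i<DIM('a). ((k + DIM('a) - 1) choose i) * ((K - (k + DIM('a) - 1)) choose (N - i)))"
proof -
  obtain C and p :: 'a where gen: "generic_nearest_point_program {..<K} C p"
    and viol: "\<And>S h. S \<subseteq> {..<K} \<Longrightarrow> S \<noteq> {} \<Longrightarrow> h < K \<Longrightarrow> x S \<notin> F h \<Longrightarrow> nearest_point_program.opt C p S \<notin> C h"
  proof -
    have "\<exists>C (p :: 'a). generic_nearest_point_program {..<K} C p \<and>
     (\<forall>S\<subseteq>{..<K}. S \<noteq> {} \<longrightarrow> (\<forall>h\<in>{..<K}. x S \<notin> F h \<longrightarrow> nearest_point_program.opt C p S \<notin> C h))"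
    proof (rule generic_perturbation)
      show "convex (F h)" if "h \<in> {..<K}" for h using F that by simp
      show "x S \<in> F h" if "S \<subseteq> {..<K}" "h \<in> S" for S h using x_in that .
      show "z = x S" if "S \<subseteq> {..<K}" "S \<noteq> {}" "\<And>h. h \<in> S \<Longrightarrow> z \<in> F h" "c \<bullet> z \<le> c \<bullet> x S" for S z
        by (rule uniq[OF that])
    qed simp
    then obtain C and p :: 'a where Cp: "generic_nearest_point_program {..<K} C p"
      "\<forall>S\<subseteq>{..<K}. S \<noteq> {} \<longrightarrow> (\<forall>h\<in>{..<K}. x S \<notin> F h \<longrightarrow> nearest_point_program.opt C p S \<notin> C h)"
      by (elim exE conjE)
    show ?thesis by (rule that[OF Cp(1)]) (use Cp(2) in simp)
  qed
  interpret generic_nearest_point_program "{..<K}" C p by (rule gen)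
  have "card {S. S \<subseteq> {..<K} \<and> card S = N \<and> k \<le> card {h. h < K \<and> x S \<notin> F h}} \<le>
      card {S. S \<subseteq> {..<K} \<and> card S = N \<and> (\<exists>B. selects DIM('a) blockers S B \<and> k \<le> card (blockers B))}"
  proof (rule card_mono)
    show "{S. S \<subseteq> {..<K} \<and> card S = N \<and> k \<le> card {h. h < K \<and> x S \<notin> F h}} \<subseteq>
      {S. S \<subseteq> {..<K} \<and> card S = N \<and> (\<exists>B. selects DIM('a) blockers S B \<and> k \<le> card (blockers B))}"
    proof safe
      fix S assume S: "S \<subseteq> {..<K}" and NS: "N = card S" and kS: "k \<le> card {h. h < K \<and> x S \<notin> F h}"
      \<comment> \<open>The empty set, about which the perturbation result says nothing, is excluded
        by \<open>DIM('a) \<le> N\<close>.\<close>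
      have ne: "S \<noteq> {}" using N(1) NS DIM_positive[where 'a='a] by (metis card.empty leD)
      obtain B where B: "selects DIM('a) blockers S B"
      proof -
        have "\<exists>!B. selects DIM('a) blockers S B"
          using basis_system_blockers S N(1) NS unfolding basis_system_def by simp
        then show ?thesis using that by (blast dest: ex1_implies_ex)
      qed
      have "{h. h < K \<and> x S \<notin> F h} \<subseteq> {h\<in>{..<K}. opt S \<notin> C h}" using viol[OF S ne] by auto
      also have "\<dots> \<subseteq> blockers B" using violators_subset_blockers[OF S B] .
      finally have "card {h. h < K \<and> x S \<notin> F h} \<le> card (blockers B)"
        by (intro card_mono) (auto simp: blockers_def)
      then show "\<exists>B. selects DIM('a) blockers S B \<and> k \<le> card (blockers B)" using B kS by (intro exI[of _ B]) simp
    qed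
  qed simp
  also have "\<dots> \<le> card {S. S \<subseteq> {..<K} \<and> card S = N \<and> card (S \<inter> {..<k + DIM('a) - 1}) < DIM('a)}"
    using basis_system_blockers N k(1) by (rule card_many_violators_le)
  also have "\<dots> \<le> (\<Sum>i<DIM('a). ((k + DIM('a) - 1) choose i) * ((K - (k + DIM('a) - 1)) choose (N - i)))"
    using k(2) by (rule card_few_small_le)
  finally show ?thesis .
qed

section \<open>Exchangeability of the scenarios\<close>

text \<open>The law is left open because two are needed: \<open>P0 \<omega>\<close> for the Monte
  Carlo bound and \<open>P\<close> for the true violation probability.\<close>

locale scenario_program = prob_space M
  for M :: "'y measure" +
  fixes X :: "'a::euclidean_space set" and c :: 'a and Xs :: "'y \<Rightarrow> 'a set"
  assumes Xs_subset: "\<xi> \<in> space M \<Longrightarrow> Xs \<xi> \<subseteq> X"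
    and Xs_convex: "\<xi> \<in> space M \<Longrightarrow> convex (Xs \<xi>)"
    and unique_solution: "1 \<le> N \<Longrightarrow> (\<forall>i<N. s i \<in> space M) \<Longrightarrow>
          \<exists>!x. is_arg_min (\<lambda>x. c \<bullet> x) (\<lambda>x. x \<in> sampled_region X Xs N s) x"
    and Xs_meas: "Measurable.pred (borel \<Otimes>\<^sub>M M) (\<lambda>(x, \<xi>). x \<in> Xs \<xi>)"
    and solution_meas: "1 \<le> N \<Longrightarrow> sampled_solution c X Xs N \<in> (\<Pi>\<^sub>M i\<in>{..<N}. M) \<rightarrow>\<^sub>M borel"
begin

abbreviation sol :: "nat \<Rightarrow> (nat \<Rightarrow> 'y) \<Rightarrow> 'a" where
  "sol \<equiv> sampled_solution c X Xs"

text \<open>A solution depends only on the set of sampled values, not on their order or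
  multiplicity. In this form any index set \<open>T\<close> can be used through its image under
  \<open>s\<close>.\<close>

definition set_sol :: "'y set \<Rightarrow> 'a" where
  "set_sol A = arg_min (\<lambda>x. c \<bullet> x) (\<lambda>x. x \<in> X \<and> (\<forall>\<xi>\<in>A. x \<in> Xs \<xi>))"

lemma sol_eq_set_sol: "sol N s = set_sol (s ` {..<N})"
proof -
  have "(\<lambda>x. x \<in> sampled_region X Xs N s) = (\<lambda>x. x \<in> X \<and> (\<forall>\<xi>\<in>s ` {..<N}. x \<in> Xs \<xi>))"
    by (auto simp: sampled_region_def)
  then show ?thesis by (simp only: sampled_solution_def set_sol_def)
qed

lemma sol_restrict: "sol N (restrict s {..<N}) = sol N s"
proof -
  have "restrict s {..<N} ` {..<N} = s ` {..<N}" by (rule image_cong) auto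
  then show ?thesis by (simp add: sol_eq_set_sol)
qed

lemma sol_props:
  assumes N: "1 \<le> N" "\<forall>i<N. s i \<in> space M"
  shows sol_in_X: "sol N s \<in> X"
    and sol_in: "i < N \<Longrightarrow> sol N s \<in> Xs (s i)"
    and sol_unique: "(\<And>i. i < N \<Longrightarrow> z \<in> Xs (s i)) \<Longrightarrow> c \<bullet> z \<le> c \<bullet> sol N s \<Longrightarrow> z = sol N s"
proof -
  let ?P = "is_arg_min (\<lambda>x. c \<bullet> x) (\<lambda>x. x \<in> sampled_region X Xs N s)"
  have ex: "\<exists>!x. ?P x" using unique_solution[OF N] .
  have P: "?P (sol N s)"
    unfolding sampled_solution_def arg_min_def by (rule someI_ex[OF ex1_implies_ex[OF ex]])
  then show "sol N s \<in> X" "i < N \<Longrightarrow> sol N s \<in> Xs (s i)"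
    by (auto simp: is_arg_min_def sampled_region_def)
  assume z: "\<And>i. i < N \<Longrightarrow> z \<in> Xs (s i)" "c \<bullet> z \<le> c \<bullet> sol N s"
  have "z \<in> X" using z(1)[of 0] Xs_subset[of "s 0"] N by auto
  then have "?P z" using P z by (fastforce simp: is_arg_min_def sampled_region_def)
  then show "z = sol N s" using ex P by blast
qed

text \<open>The assumptions speak of sequences indexed by an initial segment; an enumeration of
  \<open>T\<close> carries them over to arbitrary finite index sets, even if \<open>s\<close>
  repeats values.\<close>

lemma set_sol_image:
  assumes T: "finite T" "T \<noteq> {}" and s: "\<And>h. h \<in> T \<Longrightarrow> s h \<in> space M"
  shows "h \<in> T \<Longrightarrow> set_sol (s ` T) \<in> Xs (s h)"
    and "(\<And>h. h \<in> T \<Longrightarrow> z \<in> Xs (s h)) \<Longrightarrow> c \<bullet> z \<le> c \<bullet> set_sol (s ` T) \<Longrightarrow> z = set_sol (s ` T)"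
proof -
  obtain b where "bij_betw b {0..<card T} T" using ex_bij_betw_nat_finite[OF T(1)] by blast
  then have b: "b ` {..<card T} = T" by (simp add: bij_betw_def atLeast0LessThan)
  have N: "1 \<le> card T" using T by (simp add: Suc_le_eq card_gt_0_iff)
  have bs: "\<forall>i<card T. (s \<circ> b) i \<in> space M"
  proof (intro allI impI)
    fix i assume "i < card T"
    then have "b i \<in> T" using b by blast
    then show "(s \<circ> b) i \<in> space M" using s by simp
  qed
  have "(s \<circ> b) ` {..<card T} = s ` T" using b by (metis image_comp)
  then have eq: "sol (card T) (s \<circ> b) = set_sol (s ` T)" by (simp add: sol_eq_set_sol)
  show "set_sol (s ` T) \<in> Xs (s h)" if "h \<in> T"
  proof -
    have "h \<in> b ` {..<card T}" using b that by simp
    then obtain i where "i < card T" "b i = h" by auto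
    then show ?thesis using sol_in[OF N bs, of i] eq by (simp add: o_def)
  qed
  show "z = set_sol (s ` T)" if z: "\<And>h. h \<in> T \<Longrightarrow> z \<in> Xs (s h)" "c \<bullet> z \<le> c \<bullet> set_sol (s ` T)"
  proof -
    have "z \<in> Xs ((s \<circ> b) i)" if "i < card T" for i
    proof -
      have "b i \<in> T" using b that by blast
      then show ?thesis using z(1) by simp
    qed
    then show ?thesis using sol_unique[OF N bs, of z] z(2) by (simp add: eq[symmetric] o_def)
  qed
qed

lemma card_violating_le:
  assumes s: "\<And>h. h < K \<Longrightarrow> s h \<in> space M"
    and "DIM('a) \<le> N" "N \<le> K" "1 \<le> k" "k + DIM('a) - 1 \<le> K"
  shows "card {T. T \<subseteq> {..<K} \<and> card T = N \<and> k \<le> card {h. h < K \<and> set_sol (s ` T) \<notin> Xs (s h)}}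
    \<le> (\<Sum>i<DIM('a). ((k + DIM('a) - 1) choose i) * ((K - (k + DIM('a) - 1)) choose (N - i)))"
proof (rule card_violating_samples_le[where F = "\<lambda>h. Xs (s h)" and x = "\<lambda>T. set_sol (s ` T)" and c = c])
  fix T h assume T: "T \<subseteq> {..<K}" "h \<in> T"
  have "finite T" using T(1) by (rule finite_subset) simp
  moreover have "s h \<in> space M" if "h \<in> T" for h using s T(1) that by auto
  moreover have "T \<noteq> {}" using T(2) by auto
  ultimately show "set_sol (s ` T) \<in> Xs (s h)" using T(2) by (intro set_sol_image(1))
next
  fix T z assume T: "T \<subseteq> {..<K}" "T \<noteq> {}"
    and z: "\<And>h. h \<in> T \<Longrightarrow> z \<in> Xs (s h)" "c \<bullet> z \<le> c \<bullet> set_sol (s ` T)"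
  have "finite T" using T(1) by (rule finite_subset) simp
  moreover have "s h \<in> space M" if "h \<in> T" for h using s T(1) that by auto
  ultimately show "z = set_sol (s ` T)" using z by (intro set_sol_image(2) T(2))
qed (use assms Xs_convex in auto)

definition many_violations :: "nat \<Rightarrow> nat \<Rightarrow> nat \<Rightarrow> nat set \<Rightarrow> (nat \<Rightarrow> 'y) set" where
  "many_violations K k N T = {s \<in> space (\<Pi>\<^sub>M i\<in>{..<K}. M). k \<le> card {h. h < K \<and> set_sol (s ` T) \<notin> Xs (s h)}}"

lemma measurable_sol:
  assumes "1 \<le> N" "{..<N} \<subseteq> I"
  shows "sol N \<in> (\<Pi>\<^sub>M i\<in>I. M) \<rightarrow>\<^sub>M borel"
proof -
  have "(\<lambda>s. sol N (restrict s {..<N})) \<in> (\<Pi>\<^sub>M i\<in>I. M) \<rightarrow>\<^sub>M borel"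
    by (rule measurable_compose[OF measurable_restrict_subset[OF assms(2)] solution_meas[OF assms(1)]])
  then show ?thesis by (simp add: sol_restrict)
qed

lemma pred_violation:
  assumes "1 \<le> N" "{..<N} \<subseteq> I" "h \<in> I"
  shows "Measurable.pred (\<Pi>\<^sub>M i\<in>I. M) (\<lambda>s. sol N s \<notin> Xs (s h))"
proof -
  have "(\<lambda>s. (sol N s, s h)) \<in> (\<Pi>\<^sub>M i\<in>I. M) \<rightarrow>\<^sub>M borel \<Otimes>\<^sub>M M"
    using measurable_sol[OF assms(1,2)] measurable_component_singleton[OF assms(3)]
    by (intro measurable_Pair)
  from measurable_compose[OF this Xs_meas] show ?thesis
    by (intro pred_intros_logic) simp
qed

lemma many_violations_sets:
  assumes "1 \<le> N" "N \<le> K"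
  shows "many_violations K k N {..<N} \<in> sets (\<Pi>\<^sub>M i\<in>{..<K}. M)"
proof -
  have [measurable]: "Measurable.pred (\<Pi>\<^sub>M i\<in>{..<K}. M) (\<lambda>s. sol N s \<notin> Xs (s h))" if "h < K" for h
    using assms that by (intro pred_violation) auto
  have "(\<lambda>s. \<Sum>h<K. if sol N s \<notin> Xs (s h) then 1 else 0 :: real) \<in> borel_measurable (\<Pi>\<^sub>M i\<in>{..<K}. M)"
    by measurable
  then have "{s \<in> space (\<Pi>\<^sub>M i\<in>{..<K}. M). real k \<le> (\<Sum>h<K. if sol N s \<notin> Xs (s h) then 1 else 0)} \<in> sets (\<Pi>\<^sub>M i\<in>{..<K}. M)"
    by measurable
  moreover have "(\<Sum>h<K. if sol N s \<notin> Xs (s h) then 1 else 0 :: real) = real (card {h. h < K \<and> sol N s \<notin> Xs (s h)})" for s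
    by (simp add: sum.If_cases Int_def)
  then have "many_violations K k N {..<N} =
      {s \<in> space (\<Pi>\<^sub>M i\<in>{..<K}. M). real k \<le> (\<Sum>h<K. if sol N s \<notin> Xs (s h) then 1 else 0)}"
    unfolding many_violations_def sol_eq_set_sol[symmetric] by (simp only: of_nat_le_iff)
  ultimately show ?thesis by (simp only:)
qed

text \<open>A permutation of \<open>{..<K}\<close> that carries \<open>{..<N}\<close> onto
  \<open>T\<close> preserves the product measure and merely renames the violated constraints.
  Measurability for general \<open>T\<close> comes out the same way, as that of a preimage.\<close>

lemma many_violations_exchange:
  assumes N: "1 \<le> N" "N \<le> K" and T: "T \<subseteq> {..<K}" "card T = N"
  shows "many_violations K k N T \<in> sets (\<Pi>\<^sub>M i\<in>{..<K}. M)"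
    and "measure (\<Pi>\<^sub>M i\<in>{..<K}. M) (many_violations K k N T) = measure (\<Pi>\<^sub>M i\<in>{..<K}. M) (many_violations K k N {..<N})"
proof -
  let ?P = "\<Pi>\<^sub>M i\<in>{..<K}. M"
  have fT: "finite T" using T(1) by (rule finite_subset) simp
  obtain b1 where b1: "bij_betw b1 {..<N} T"
    using T(2) fT by (metis card_lessThan finite_lessThan finite_same_card_bij)
  have "card ({..<K} - {..<N}) = card ({..<K} - T)" using T N fT by (simp add: card_Diff_subset)
  then obtain b2 where b2: "bij_betw b2 ({..<K} - {..<N}) ({..<K} - T)"
    by (metis finite_Diff finite_lessThan finite_same_card_bij)
  define b where "b i = (if i \<in> {..<N} then b1 i else b2 i)" for i
  have b: "bij_betw b ({..<N} \<union> ({..<K} - {..<N})) (T \<union> ({..<K} - T))"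
    unfolding b_def by (rule bij_betw_disjoint_Un[OF b1 b2]) auto
  have "{..<N} \<union> ({..<K} - {..<N}) = {..<K}" "T \<union> ({..<K} - T) = {..<K}" using N T by auto
  then have bK: "bij_betw b {..<K} {..<K}" using b by simp
  have bN: "b ` {..<N} = T" using b1 by (auto simp: b_def bij_betw_def image_iff)
  define \<phi> where "\<phi> s = (\<lambda>i\<in>{..<K}. s (b i))" for s :: "nat \<Rightarrow> 'y"
  have b_in: "b i \<in> {..<K}" if "i \<in> {..<K}" for i using bK that by (auto simp: bij_betw_def)
  have \<phi>: "\<phi> \<in> ?P \<rightarrow>\<^sub>M ?P"
    unfolding \<phi>_def by (intro measurable_restrict measurable_component_singleton b_in)
  have distr: "distr ?P ?P \<phi> = ?P"
    unfolding \<phi>_def using bK b_in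
    by (intro distr_PiM_reindex) (auto simp: bij_betw_def intro: prob_space_axioms)
  have iff: "\<phi> s \<in> many_violations K k N {..<N} \<longleftrightarrow> s \<in> many_violations K k N T" if s: "s \<in> space ?P" for s
  proof -
    have sp: "\<phi> s \<in> space ?P" using measurable_space[OF \<phi> s] .
    have "\<phi> s ` {..<N} = s ` (b ` {..<N})"
      unfolding image_image using N by (intro image_cong) (auto simp: \<phi>_def)
    then have im: "\<phi> s ` {..<N} = s ` T" using bN by simp
    have "bij_betw b {h. h < K \<and> set_sol (s ` T) \<notin> Xs (s (b h))} {h. h < K \<and> set_sol (s ` T) \<notin> Xs (s h)}"
    proof (rule bij_betw_subset[OF bK])
      show "b ` {h. h < K \<and> set_sol (s ` T) \<notin> Xs (s (b h))} = {h. h < K \<and> set_sol (s ` T) \<notin> Xs (s h)}"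
        using bK unfolding bij_betw_def by (auto simp: image_iff)
    qed auto
    moreover have "{h. h < K \<and> set_sol (s ` T) \<notin> Xs (\<phi> s h)} = {h. h < K \<and> set_sol (s ` T) \<notin> Xs (s (b h))}"
      by (auto simp: \<phi>_def)
    ultimately have "card {h. h < K \<and> set_sol (s ` T) \<notin> Xs (\<phi> s h)} = card {h. h < K \<and> set_sol (s ` T) \<notin> Xs (s h)}"
      by (simp add: bij_betw_same_card)
    then show ?thesis using s sp im by (simp add: many_violations_def)
  qed
  have pre: "\<phi> -` many_violations K k N {..<N} \<inter> space ?P = many_violations K k N T"
    using iff by (auto simp: many_violations_def)
  have E0: "many_violations K k N {..<N} \<in> sets ?P" by (rule many_violations_sets[OF N])
  show "many_violations K k N T \<in> sets ?P" using measurable_sets[OF \<phi> E0] pre by simp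
  have "measure ?P (many_violations K k N {..<N}) = measure (distr ?P ?P \<phi>) (many_violations K k N {..<N})"
    by (simp only: distr)
  also have "\<dots> = measure ?P (many_violations K k N T)" using measure_distr[OF \<phi> E0] pre by simp
  finally show "measure ?P (many_violations K k N T) = measure ?P (many_violations K k N {..<N})" by simp
qed

text \<open>All \<open>N\<close>-subsets give the same probability, so the left-hand side is the
  expected number of \<open>N\<close>-subsets with at least \<open>k\<close> violations, and the
  counting bound holds for every realization.\<close>

lemma prob_many_violations_le:
  assumes "DIM('a) \<le> N" "N \<le> K" "1 \<le> k" "k + DIM('a) - 1 \<le> K"
  shows "real (K choose N) * measure (\<Pi>\<^sub>M i\<in>{..<K}. M) (many_violations K k N {..<N}) \<le>
    (\<Sum>i<DIM('a). real ((k + DIM('a) - 1) choose i) * real ((K - (k + DIM('a) - 1)) choose (N - i)))"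
    (is "_ \<le> ?R")
proof -
  let ?P = "\<Pi>\<^sub>M i\<in>{..<K}. M"
  interpret P: prob_space ?P by (intro prob_space_PiM prob_space_axioms)
  have N1: "1 \<le> N" using assms(1) DIM_positive[where 'a='a] by linarith
  define \<T> where "\<T> = {T. T \<subseteq> {..<K} \<and> card T = N}"
  have f\<T>: "finite \<T>" by (simp add: \<T>_def)
  have c\<T>: "card \<T> = K choose N" by (simp add: \<T>_def n_subsets)
  have meas: "many_violations K k N T \<in> sets ?P" if "T \<in> \<T>" for T
    using that by (intro many_violations_exchange(1)[OF N1 assms(2)]) (simp_all add: \<T>_def)
  have "real (K choose N) * measure ?P (many_violations K k N {..<N}) = (\<Sum>T\<in>\<T>. measure ?P (many_violations K k N T))"
  proof -
    have "(\<Sum>T\<in>\<T>. measure ?P (many_violations K k N T)) =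
        (\<Sum>T\<in>\<T>. measure ?P (many_violations K k N {..<N}))"
    proof (rule sum.cong[OF refl])
      fix T assume "T \<in> \<T>"
      then have "T \<subseteq> {..<K}" "card T = N" by (simp_all add: \<T>_def)
      then show "measure ?P (many_violations K k N T) = measure ?P (many_violations K k N {..<N})"
        by (rule many_violations_exchange(2)[OF N1 assms(2)])
    qed
    then show ?thesis using c\<T> by simp
  qed
  also have "\<dots> = (\<Sum>T\<in>\<T>. integral\<^sup>L ?P (indicator (many_violations K k N T)))"
    using meas by (intro sum.cong) auto
  also have "\<dots> = integral\<^sup>L ?P (\<lambda>s. \<Sum>T\<in>\<T>. indicator (many_violations K k N T) s)"
    using meas by (intro Bochner_Integration.integral_sum[symmetric]) (auto simp: P.emeasure_eq_measure)
  also have "\<dots> \<le> integral\<^sup>L ?P (\<lambda>s. ?R)"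
  proof (rule integral_mono)
    show "integrable ?P (\<lambda>s. \<Sum>T\<in>\<T>. indicator (many_violations K k N T) s :: real)"
      using meas by (intro Bochner_Integration.integrable_sum) (auto simp: P.emeasure_eq_measure)
    fix s assume s: "s \<in> space ?P"
    have sp: "s h \<in> space M" if "h < K" for h using s that by (auto simp: space_PiM dest: PiE_mem)
    have "(\<Sum>T\<in>\<T>. indicator (many_violations K k N T) s :: real) = real (card {T\<in>\<T>. s \<in> many_violations K k N T})"
      using f\<T> by (simp add: indicator_def sum.If_cases Int_def)
    also have "{T\<in>\<T>. s \<in> many_violations K k N T} =
        {T. T \<subseteq> {..<K} \<and> card T = N \<and> k \<le> card {h. h < K \<and> set_sol (s ` T) \<notin> Xs (s h)}}"
      using s by (auto simp: \<T>_def many_violations_def)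
    also have "real (card \<dots>) \<le> ?R"
      using card_violating_le[OF sp assms] by (simp flip: of_nat_mult of_nat_sum)
    finally show "(\<Sum>T\<in>\<T>. indicator (many_violations K k N T) s) \<le> ?R" .
  qed auto
  also have "\<dots> = ?R" by (simp add: P.prob_space)
  finally show ?thesis .
qed

end

section \<open>The violation probability\<close>

lemma (in prob_space) prob_few_hits_le:
  fixes J :: "'i set"
  assumes J: "finite J" "J \<noteq> {}" and A: "A \<in> events" and a: "a \<le> prob A"
  shows "measure (\<Pi>\<^sub>M i\<in>J. M) {t \<in> space (\<Pi>\<^sub>M i\<in>J. M). real (card {h\<in>J. t h \<in> A}) \<le> real (card J) * a}
    \<le> exp (- 2 * real (card J) * (prob A - a)\<^sup>2)"
proof -
  let ?P = "\<Pi>\<^sub>M i\<in>J. M"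
  obtain j where j: "j \<in> J" using J by auto
  interpret P: prob_space ?P by (intro prob_space_PiM prob_space_axioms)
  define Z where "Z i t = indicat_real A (t i)" for i :: 'i and t :: "'i \<Rightarrow> 'a"
  have Z_meas: "Z i \<in> borel_measurable ?P" if "i \<in> J" for i
    unfolding Z_def using that A by measurable
  have ev: "(\<lambda>t. t i) \<in> ?P \<rightarrow>\<^sub>M M" if "i \<in> J" for i using that by measurable
  have comp: "distr ?P M (\<lambda>t. t i) = M" if "i \<in> J" for i
    using distr_PiM_component[of J "\<lambda>_. M" i] that prob_space_axioms by auto
  have dZ: "distr ?P borel (Z i) = distr M borel (indicat_real A)" if "i \<in> J" for i
  proof -
    have "distr ?P borel (Z i) = distr (distr ?P M (\<lambda>t. t i)) borel (indicat_real A)"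
      using A ev[OF that] by (subst distr_distr) (auto simp: o_def Z_def[abs_def])
    then show ?thesis using comp[OF that] by simp
  qed
  have ind: "P.indep_vars (\<lambda>_. borel) Z J"
  proof -
    have "P.indep_vars (\<lambda>_. M) (\<lambda>i t. t i) J"
    proof (subst P.indep_vars_iff_distr_eq_PiM'[OF J(2) ev])
      have "distr ?P ?P (\<lambda>x. \<lambda>i\<in>J. x i) = distr ?P ?P (\<lambda>x. x)"
        by (rule distr_cong) (auto simp: space_PiM)
      also have "\<dots> = ?P" by (rule distr_id)
      also have "?P = (\<Pi>\<^sub>M i\<in>J. distr ?P M (\<lambda>t. t i))"
        by (rule PiM_cong[OF refl comp[symmetric]])
      finally show "distr ?P ?P (\<lambda>x. \<lambda>i\<in>J. x i) = (\<Pi>\<^sub>M i\<in>J. distr ?P M (\<lambda>t. t i))" .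
    qed
    then have "P.indep_vars (\<lambda>_. borel) (\<lambda>i t. indicat_real A (t i)) J"
      by (rule P.indep_vars_compose2) (use A in auto)
    then show ?thesis by (simp add: Z_def[abs_def])
  qed
  have exp: "P.expectation (Z j) = prob A"
  proof -
    have "P.expectation (Z j) = integral\<^sup>L (distr ?P M (\<lambda>t. t j)) (indicat_real A)"
      using A ev[OF j] by (subst integral_distr) (auto simp: Z_def[abs_def])
    then show ?thesis using comp[OF j] A by simp
  qed
  interpret H: Hoeffding_ineq_iid ?P J Z "Z j" 0 1 "prob A"
  proof unfold_locales
    show "prob A \<equiv> P.expectation (Z j)" using exp by simp
  qed (use J ind dZ j Z_meas in \<open>auto simp: Z_def\<close>)
  have cpos: "0 < real (card J)" using J by (simp add: card_gt_0_iff)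
  have "measure ?P {t \<in> space ?P. (\<Sum>i\<in>J. Z i t) \<le> card J * prob A - card J * (prob A - a)}
      \<le> exp (- 2 * (card J * (prob A - a))\<^sup>2 / (real (card J) * (1 - 0)\<^sup>2))"
    by (rule H.Hoeffding_ineq_le) (use a J in auto)
  also have "- 2 * (card J * (prob A - a))\<^sup>2 / (real (card J) * (1 - 0)\<^sup>2) = - 2 * card J * (prob A - a)\<^sup>2"
    using cpos by (simp add: power2_eq_square field_simps)
  also have "card J * prob A - card J * (prob A - a) = card J * a" by (simp add: algebra_simps)
  also have "(\<lambda>t. \<Sum>i\<in>J. Z i t) = (\<lambda>t. real (card {h\<in>J. t h \<in> A}))"
    using J by (simp add: Z_def indicator_def sum.If_cases Int_def)
  finally show ?thesis by simp
qed

text \<open>Division by \<open>m ^ i\<close> turns the falling factorial in the binomial coefficient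
  into a product of \<open>i\<close> factors \<open>f m / m - j / m\<close>, each tending to
  \<open>a\<close>.\<close>

lemma choose_asymp:
  assumes "(\<lambda>m. real (f m) / real m) \<longlonglongrightarrow> a"
  shows "(\<lambda>m. real (f m choose i) / real m ^ i) \<longlonglongrightarrow> a ^ i / fact i"
proof -
  have "(\<lambda>m. (\<Prod>j<i. real (f m) / real m - real j / real m) / fact i) \<longlonglongrightarrow> (\<Prod>j<i. a - 0) / fact i"
    by (intro tendsto_intros assms lim_const_over_n) auto
  moreover have "(\<Prod>j<i. real (f m) / real m - real j / real m) / fact i = real (f m choose i) / real m ^ i" for m
  proof -
    have "real (f m choose i) = (\<Prod>j<i. real (f m) - real j) / fact i"
      by (simp add: binomial_gbinomial gbinomial_prod_rev atLeast0LessThan)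
    then show ?thesis by (simp add: prod_dividef flip: diff_divide_distrib)
  qed
  ultimately show ?thesis by simp
qed

text \<open>Drawing \<open>N\<close> times from a growing population without replacement becomes
  drawing with replacement when the marked fraction tends to \<open>a\<close>. The normalising
  powers of \<open>m\<close> cancel because \<open>i + (N - i) = N\<close>.\<close>

lemma hypergeometric_term_asymp:
  assumes L: "(\<lambda>m. real (L m) / real m) \<longlonglongrightarrow> a" and LK: "\<And>m. L m \<le> N + m" and i: "i \<le> N"
  shows "(\<lambda>m. real (L m choose i) * real ((N + m - L m) choose (N - i)) / real ((N + m) choose N))
    \<longlonglongrightarrow> real (N choose i) * a ^ i * (1 - a) ^ (N - i)"
proof -
  have K: "(\<lambda>m. real (N + m) / real m) \<longlonglongrightarrow> 1"
    by real_asymp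
  have "(\<lambda>m. real (N + m) / real m - real (L m) / real m) \<longlonglongrightarrow> 1 - a"
    by (intro tendsto_intros K L)
  then have KL: "(\<lambda>m. real (N + m - L m) / real m) \<longlonglongrightarrow> 1 - a"
  proof (rule Lim_transform_eventually)
    show "\<forall>\<^sub>F m in sequentially. real (N + m) / real m - real (L m) / real m = real (N + m - L m) / real m"
      using LK by (intro always_eventually allI) (simp add: of_nat_diff diff_divide_distrib)
  qed
  have "(\<lambda>m. (real (L m choose i) / real m ^ i) * (real ((N + m - L m) choose (N - i)) / real m ^ (N - i)) / (real ((N + m) choose N) / real m ^ N))
     \<longlonglongrightarrow> (a ^ i / fact i) * ((1 - a) ^ (N - i) / fact (N - i)) / (1 ^ N / fact N)"
    by (intro tendsto_intros choose_asymp K KL L) simp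
  also have "(a ^ i / fact i) * ((1 - a) ^ (N - i) / fact (N - i)) / (1 ^ N / fact N) = real (N choose i) * a ^ i * (1 - a) ^ (N - i)"
    using i by (simp add: binomial_fact)
  finally show ?thesis
  proof (rule Lim_transform_eventually)
    show "\<forall>\<^sub>F m in sequentially.
       (real (L m choose i) / real m ^ i) * (real ((N + m - L m) choose (N - i)) / real m ^ (N - i)) / (real ((N + m) choose N) / real m ^ N) =
       real (L m choose i) * real ((N + m - L m) choose (N - i)) / real ((N + m) choose N)"
      using eventually_gt_at_top[of 0]
    proof eventually_elim
      case (elim m)
      have "real m ^ N = real m ^ i * real m ^ (N - i)" using i by (simp flip: power_add)
      then show ?case using elim by simp
    qed
  qed
qed

context scenario_program
begin

definition violation :: "'a \<Rightarrow> real" where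
  "violation x = prob {\<xi> \<in> space M. x \<notin> Xs \<xi>}"

lemma violating_sets: "{\<xi> \<in> space M. x \<notin> Xs \<xi>} \<in> events"
proof -
  have "(\<lambda>\<xi>. (x, \<xi>)) \<in> M \<rightarrow>\<^sub>M borel \<Otimes>\<^sub>M M" by simp
  from measurable_compose[OF this Xs_meas] have [measurable]: "Measurable.pred M (\<lambda>\<xi>. x \<in> Xs \<xi>)"
    by simp
  show ?thesis by measurable
qed

lemma violation_measurable: "violation \<in> borel_measurable borel"
proof -
  have [measurable]: "Measurable.pred (borel \<Otimes>\<^sub>M M) (\<lambda>z. fst z \<in> Xs (snd z))"
    using Xs_meas by (simp add: case_prod_beta')
  have "{z \<in> space (borel \<Otimes>\<^sub>M M). fst z \<notin> Xs (snd z)} \<in> sets (borel \<Otimes>\<^sub>M M)" by measurable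
  from measurable_emeasure_Pair[OF this]
  have "(\<lambda>x. emeasure M (Pair x -` {z \<in> space (borel \<Otimes>\<^sub>M M). fst z \<notin> Xs (snd z)})) \<in> borel_measurable borel" .
  moreover have "Pair x -` {z \<in> space (borel \<Otimes>\<^sub>M M). fst z \<notin> Xs (snd z)} = {\<xi> \<in> space M. x \<notin> Xs \<xi>}" for x :: 'a
    by (auto simp: space_pair_measure)
  ultimately show ?thesis unfolding violation_def[abs_def] measure_def by simp
qed

lemma large_violation_sets:
  assumes "1 \<le> N" "{..<N} \<subseteq> I"
  shows "{s \<in> space (\<Pi>\<^sub>M i\<in>I. M). \<epsilon> < violation (sol N s)} \<in> sets (\<Pi>\<^sub>M i\<in>I. M)"
proof -
  have [measurable]: "(\<lambda>s. violation (sol N s)) \<in> borel_measurable (\<Pi>\<^sub>M i\<in>I. M)"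
    by (rule measurable_compose[OF measurable_sol[OF assms] violation_measurable])
  show ?thesis by measurable
qed

text \<open>The first \<open>N\<close> scenarios determine the solution and the other
  \<open>m\<close> test it independently. Given a violation probability above
  \<open>\<epsilon>\<close>, Hoeffding's inequality makes at least \<open>\<epsilon>' * m\<close> of
  the tests fail except with exponentially small probability; Fubini's theorem then integrates over
  the first \<open>N\<close>.\<close>

lemma prob_large_violation_le_many:
  assumes N: "1 \<le> N" and m: "1 \<le> m" and e: "0 < \<epsilon>'" "\<epsilon>' < \<epsilon>"
  defines "k \<equiv> nat \<lceil>\<epsilon>' * real m\<rceil>"
  shows "(1 - exp (- 2 * real m * (\<epsilon> - \<epsilon>')\<^sup>2)) *
      measure (\<Pi>\<^sub>M i\<in>{..<N}. M) {s \<in> space (\<Pi>\<^sub>M i\<in>{..<N}. M). \<epsilon> < violation (sol N s)}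
    \<le> measure (\<Pi>\<^sub>M i\<in>{..<N + m}. M) (many_violations (N + m) k N {..<N})"
proof -
  let ?I = "{..<N}" and ?J = "{N..<N + m}"
  let ?PI = "\<Pi>\<^sub>M i\<in>?I. M" and ?PJ = "\<Pi>\<^sub>M i\<in>?J. M" and ?P = "\<Pi>\<^sub>M i\<in>{..<N + m}. M"
  interpret I: prob_space ?PI by (intro prob_space_PiM prob_space_axioms)
  interpret J: prob_space ?PJ by (intro prob_space_PiM prob_space_axioms)
  interpret P: prob_space ?P by (intro prob_space_PiM prob_space_axioms)
  interpret product_sigma_finite "\<lambda>_ :: nat. M" by standard
  have IJ: "?I \<union> ?J = {..<N + m}" "?I \<inter> ?J = {}" by auto
  define E where "E = many_violations (N + m) k N ?I"
  define D where "D = {s \<in> space ?PI. \<epsilon> < violation (sol N s)}"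
  define q where "q = 1 - exp (- 2 * real m * (\<epsilon> - \<epsilon>')\<^sup>2)"
  have q: "0 \<le> q" by (simp add: q_def)
  have E: "E \<in> sets ?P" unfolding E_def using N by (intro many_violations_sets) auto
  have D: "D \<in> sets ?PI" unfolding D_def using N by (intro large_violation_sets) auto
  have inner: "ennreal q \<le> (\<integral>\<^sup>+t. indicator E (merge ?I ?J (s, t)) \<partial>?PJ)" if s: "s \<in> D" for s
  proof -
    have sI: "s \<in> space ?PI" using s by (simp add: D_def)
    define A where "A = {\<xi> \<in> space M. sol N s \<notin> Xs \<xi>}"
    have A: "A \<in> events" unfolding A_def by (rule violating_sets)
    have vA: "\<epsilon> < prob A" using s by (simp add: D_def violation_def A_def)
    define B where "B = {t \<in> space ?PJ. real (card {h\<in>?J. t h \<in> A}) \<le> real (card ?J) * \<epsilon>'}"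
    have B: "B \<in> sets ?PJ"
    proof -
      have [measurable]: "Measurable.pred ?PJ (\<lambda>t. t h \<in> A)" if "h \<in> ?J" for h
        using A that by measurable
      have "(\<lambda>t. \<Sum>h\<in>?J. if t h \<in> A then 1 else 0 :: real) \<in> borel_measurable ?PJ"
        by measurable
      then have "{t \<in> space ?PJ. (\<Sum>h\<in>?J. if t h \<in> A then 1 else 0) \<le> real (card ?J) * \<epsilon>'} \<in> sets ?PJ"
        by measurable
      moreover have "(\<Sum>h\<in>?J. if t h \<in> A then 1 else 0 :: real) = real (card {h\<in>?J. t h \<in> A})" for t
        by (simp add: sum.If_cases Int_def)
      ultimately show ?thesis by (simp only: B_def)
    qed
    have "measure ?PJ B \<le> exp (- 2 * real (card ?J) * (prob A - \<epsilon>')\<^sup>2)"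
      unfolding B_def using m vA e A by (intro prob_few_hits_le) auto
    also have "\<dots> \<le> exp (- 2 * real m * (\<epsilon> - \<epsilon>')\<^sup>2)"
    proof -
      have "(\<epsilon> - \<epsilon>')\<^sup>2 \<le> (prob A - \<epsilon>')\<^sup>2" using vA e by (intro power_mono) auto
      then show ?thesis by (simp add: mult_left_mono)
    qed
    finally have "q \<le> measure ?PJ (space ?PJ - B)"
      using J.prob_compl[OF B] by (simp add: q_def)
    then have "ennreal q \<le> emeasure ?PJ (space ?PJ - B)" by (simp add: J.emeasure_eq_measure)
    also have "\<dots> = (\<integral>\<^sup>+t. indicator (space ?PJ - B) t \<partial>?PJ)"
      by (rule nn_integral_indicator[symmetric, OF sets.compl_sets[OF B]])
    also have "\<dots> \<le> (\<integral>\<^sup>+t. indicator E (merge ?I ?J (s, t)) \<partial>?PJ)"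
    proof (rule nn_integral_mono)
      fix t assume t: "t \<in> space ?PJ"
      show "indicator (space ?PJ - B) t \<le> (indicator E (merge ?I ?J (s, t)) :: ennreal)"
      proof (cases "t \<in> B")
        case True
        then show ?thesis by simp
      next
        case False
        define w where "w = merge ?I ?J (s, t)"
        have w_sp: "w \<in> space ?P"
        proof -
          have "(s, t) \<in> space (?PI \<Otimes>\<^sub>M ?PJ)" using sI t by (simp add: space_pair_measure)
          then have "w \<in> space (\<Pi>\<^sub>M i\<in>?I \<union> ?J. M)" unfolding w_def by (rule measurable_space[OF measurable_merge])
          then show ?thesis by (simp only: IJ)
        qed
        have wI: "w i = s i" if "i < N" for i using that by (simp add: w_def merge_def)
        have wJ: "w i = t i" if "i \<in> ?J" for i using that by (simp add: w_def merge_def)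
        have "w ` ?I = s ` ?I" by (rule image_cong) (simp_all add: wI)
        then have sol_w: "set_sol (w ` ?I) = sol N s" by (simp only: sol_eq_set_sol)
        have "t \<in> ?J \<rightarrow>\<^sub>E space M" using t by (simp only: space_PiM)
        then have "t h \<in> space M" if "h \<in> ?J" for h using that by (rule PiE_mem)
        then have sub: "{h\<in>?J. t h \<in> A} \<subseteq> {h. h < N + m \<and> set_sol (w ` ?I) \<notin> Xs (w h)}"
          using sol_w wJ by (auto simp: A_def)
        have "real m * \<epsilon>' < real (card {h\<in>?J. t h \<in> A})" using False t by (simp add: B_def)
        then have "k \<le> card {h\<in>?J. t h \<in> A}" unfolding k_def by (simp add: ceiling_le_iff mult.commute)
        also have "\<dots> \<le> card {h. h < N + m \<and> set_sol (w ` ?I) \<notin> Xs (w h)}" using sub by (intro card_mono) auto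
        finally have "w \<in> E" using w_sp by (simp add: E_def many_violations_def)
        then show ?thesis by (simp add: w_def indicator_def)
      qed
    qed
    finally show ?thesis .
  qed
  have "ennreal (q * measure ?PI D) = ennreal q * emeasure ?PI D"
    using q by (simp add: I.emeasure_eq_measure ennreal_mult)
  also have "\<dots> = (\<integral>\<^sup>+s. ennreal q * indicator D s \<partial>?PI)" using D by (simp add: nn_integral_cmult_indicator)
  also have "\<dots> \<le> (\<integral>\<^sup>+s. (\<integral>\<^sup>+t. indicator E (merge ?I ?J (s, t)) \<partial>?PJ) \<partial>?PI)"
    using inner by (intro nn_integral_mono) (auto simp: indicator_def)
  also have "\<dots> = (\<integral>\<^sup>+w. indicator E w \<partial>(\<Pi>\<^sub>M i\<in>?I \<union> ?J. M))"
  proof (rule product_nn_integral_fold[symmetric])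
    show "(\<lambda>w. indicator E w :: ennreal) \<in> borel_measurable (\<Pi>\<^sub>M i\<in>?I \<union> ?J. M)"
      using E by (simp only: IJ borel_measurable_indicator)
  qed auto
  also have "\<dots> = ennreal (measure ?P E)" using E by (simp only: IJ nn_integral_indicator P.emeasure_eq_measure)
  finally show ?thesis by (simp add: q_def D_def E_def)
qed

lemma prob_large_violation_le:
  assumes N: "DIM('a) \<le> N" and e: "0 < \<epsilon>" "\<epsilon> < 1"
  shows "measure (\<Pi>\<^sub>M i\<in>{..<N}. M) {s \<in> space (\<Pi>\<^sub>M i\<in>{..<N}. M). \<epsilon> < violation (sol N s)}
    \<le> (\<Sum>i<DIM('a). real (N choose i) * \<epsilon> ^ i * (1 - \<epsilon>) ^ (N - i))" (is "?p \<le> ?g \<epsilon>")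
proof -
  have N1: "1 \<le> N" using N DIM_positive[where 'a='a] by linarith
  have bound: "?p \<le> ?g \<epsilon>'" if e': "0 < \<epsilon>'" "\<epsilon>' < \<epsilon>" for \<epsilon>'
  proof -
    define k where "k m = nat \<lceil>\<epsilon>' * real m\<rceil>" for m
    \<comment> \<open>\<open>L m\<close> is the length of the initial block in the counting bound.
      Its additive part \<open>DIM('a) - 1\<close> disappears in the limit, so the block has
      asymptotic share \<open>\<epsilon>'\<close>.\<close>
    define L where "L m = k m + DIM('a) - 1" for m
    have L_eq: "L m = k m + (DIM('a) - 1)" for m using DIM_positive[where 'a='a] by (simp add: L_def)
    have k_real: "real (k m) = of_int \<lceil>\<epsilon>' * real m\<rceil>" for m using e' by (simp add: k_def)
    have k1: "1 \<le> k m" if "1 \<le> m" for m using e' that by (simp add: k_def Suc_le_eq)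
    have km: "k m \<le> m" for m
    proof -
      have "\<epsilon>' * real m \<le> 1 * real m" using e e' by (intro mult_right_mono) auto
      then show ?thesis by (simp add: k_def ceiling_le_iff)
    qed
    have LK: "L m \<le> N + m" for m using km[of m] N by (simp add: L_def)
    have "(\<lambda>m. real (k m) / real m) \<longlonglongrightarrow> \<epsilon>'"
    proof (rule tendsto_sandwich[of "\<lambda>_. \<epsilon>'" _ _ "\<lambda>m. \<epsilon>' + 1 / real m"])
      show "\<forall>\<^sub>F m in sequentially. \<epsilon>' \<le> real (k m) / real m"
        using eventually_gt_at_top[of 0] by eventually_elim (simp add: k_real field_simps)
      show "\<forall>\<^sub>F m in sequentially. real (k m) / real m \<le> \<epsilon>' + 1 / real m"
        using eventually_gt_at_top[of 0]
      proof eventually_elim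
        case (elim m)
        have "real (k m) \<le> \<epsilon>' * real m + 1" unfolding k_real by linarith
        then show ?case using elim by (simp add: field_simps)
      qed
      show "(\<lambda>m. \<epsilon>' + 1 / real m) \<longlonglongrightarrow> \<epsilon>'" by real_asymp
    qed simp
    then have "(\<lambda>m. real (k m) / real m + real (DIM('a) - 1) / real m) \<longlonglongrightarrow> \<epsilon>' + 0"
      by (intro tendsto_add lim_const_over_n)
    then have L_lim: "(\<lambda>m. real (L m) / real m) \<longlonglongrightarrow> \<epsilon>'"
      unfolding L_eq of_nat_add add_divide_distrib by (simp only: add_0_right)
    have le: "(1 - exp (- 2 * real m * (\<epsilon> - \<epsilon>')\<^sup>2)) * ?p \<le>
        (\<Sum>i<DIM('a). real (L m choose i) * real ((N + m - L m) choose (N - i)) / real ((N + m) choose N))"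
      if m: "1 \<le> m" for m
    proof -
      let ?E = "measure (\<Pi>\<^sub>M i\<in>{..<N + m}. M) (many_violations (N + m) (k m) N {..<N})"
      have "real ((N + m) choose N) * ?E \<le> (\<Sum>i<DIM('a). real (L m choose i) * real ((N + m - L m) choose (N - i)))"
        using prob_many_violations_le[of N "N + m" "k m"] N k1[OF m] LK[of m] by (simp add: L_def)
      moreover have "0 < real ((N + m) choose N)" by simp
      ultimately have "?E \<le> (\<Sum>i<DIM('a). real (L m choose i) * real ((N + m - L m) choose (N - i))) / real ((N + m) choose N)"
        by (simp add: field_simps)
      then show ?thesis
        using prob_large_violation_le_many[OF N1 m e'] by (simp add: k_def sum_divide_distrib)
    qed
    have "(\<lambda>m. (1 - exp (- 2 * real m * (\<epsilon> - \<epsilon>')\<^sup>2)) * ?p) \<longlonglongrightarrow> (1 - 0) * ?p"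
    proof (intro tendsto_intros)
      have "0 < 2 * (\<epsilon> - \<epsilon>')\<^sup>2" using e' by simp
      then have "(\<lambda>m. exp (- (2 * (\<epsilon> - \<epsilon>')\<^sup>2) * real m)) \<longlonglongrightarrow> 0" by real_asymp
      then show "(\<lambda>m. exp (- 2 * real m * (\<epsilon> - \<epsilon>')\<^sup>2)) \<longlonglongrightarrow> 0" by (simp add: mult_ac)
    qed
    moreover have "(\<lambda>m. \<Sum>i<DIM('a). real (L m choose i) * real ((N + m - L m) choose (N - i)) / real ((N + m) choose N)) \<longlonglongrightarrow> ?g \<epsilon>'"
      using LK N by (intro tendsto_sum hypergeometric_term_asymp L_lim) auto
    ultimately have "(1 - 0) * ?p \<le> ?g \<epsilon>'"
      by (rule LIMSEQ_le) (use le in blast)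
    then show ?thesis by simp
  qed
  \<comment> \<open>Hoeffding's inequality needs a gap between \<open>\<epsilon>'\<close> and
    \<open>\<epsilon>\<close>; it is closed only after \<open>m\<close> has gone to
    infinity.\<close>
  have "(?g \<longlongrightarrow> ?g \<epsilon>) (at_left \<epsilon>)" by (intro tendsto_intros)
  moreover have "\<forall>\<^sub>F \<epsilon>' in at_left \<epsilon>. ?p \<le> ?g \<epsilon>'"
    using eventually_at_left_real[OF e(1)] by eventually_elim (use bound in auto)
  ultimately show ?thesis by (rule tendsto_lowerbound) simp
qed

end

section \<open>Robust and chance-constrained feasibility\<close>

text \<open>Needed so that the \<open>LEAST\<close> in \<open>N_exact\<close> ranges over a nonempty
  set. Each summand grows at most polynomially in \<open>n\<close> apart from the geometric factor
  \<open>q ^ n\<close>.\<close>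

lemma binomial_tail_tendsto_0:
  fixes \<delta> :: real
  assumes "0 < \<delta>" "\<delta> < 1"
  shows "(\<lambda>n. \<Sum>i<d. real (n choose i) * \<delta> ^ i * (1 - \<delta>) ^ (n - i)) \<longlonglongrightarrow> 0"
proof -
  define q where "q = 1 - \<delta>"
  have q: "0 < q" "q < 1" using assms by (simp_all add: q_def)
  have "(\<lambda>n. real (n choose i) * \<delta> ^ i * q ^ (n - i)) \<longlonglongrightarrow> 0" for i
  proof -
    have "(\<lambda>n. real n / real n) \<longlonglongrightarrow> 1" by real_asymp
    then have c: "(\<lambda>n. real (n choose i) / real n ^ i) \<longlonglongrightarrow> 1 ^ i / fact i"
      by (rule choose_asymp)
    have "(\<lambda>n. real n ^ i * q ^ n) \<longlonglongrightarrow> 0" using q by real_asymp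
    then have "(\<lambda>n. (real (n choose i) / real n ^ i) * (real n ^ i * q ^ n) * (\<delta> ^ i / q ^ i)) \<longlonglongrightarrow> 1 ^ i / fact i * 0 * (\<delta> ^ i / q ^ i)"
      by (intro tendsto_mult c tendsto_const)
    then have "(\<lambda>n. (real (n choose i) / real n ^ i) * (real n ^ i * q ^ n) * (\<delta> ^ i / q ^ i)) \<longlonglongrightarrow> 0" by simp
    then show ?thesis
    proof (rule Lim_transform_eventually)
      show "\<forall>\<^sub>F n in sequentially. (real (n choose i) / real n ^ i) * (real n ^ i * q ^ n) * (\<delta> ^ i / q ^ i) =
          real (n choose i) * \<delta> ^ i * q ^ (n - i)"
        using eventually_ge_at_top[of "Suc i"]
        by eventually_elim (use q in \<open>simp add: power_diff\<close>)
    qed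
  qed
  then have "(\<lambda>n. \<Sum>i<d. real (n choose i) * \<delta> ^ i * q ^ (n - i)) \<longlonglongrightarrow> (\<Sum>i<d. 0)"
    by (intro tendsto_sum)
  then show ?thesis by (simp add: q_def)
qed

text \<open>With fewer than \<open>d\<close> trials the sum is a complete binomial expansion. As its
  value exceeds \<beta>, \<open>N_exact\<close> cannot lie below \<open>d\<close>, which the
  counting argument requires.\<close>

lemma binomial_sum_lessThan:
  fixes \<delta> :: real
  assumes "n < d"
  shows "(\<Sum>i<d. real (n choose i) * \<delta> ^ i * (1 - \<delta>) ^ (n - i)) = 1"
proof -
  have "(\<Sum>i<d. real (n choose i) * \<delta> ^ i * (1 - \<delta>) ^ (n - i)) = (\<Sum>i\<le>n. real (n choose i) * \<delta> ^ i * (1 - \<delta>) ^ (n - i))"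
    by (rule sum.mono_neutral_right) (use assms in \<open>auto intro: binomial_eq_0\<close>)
  also have "\<dots> = (\<delta> + (1 - \<delta>)) ^ n" by (rule binomial_ring[symmetric])
  finally show ?thesis by simp
qed

lemma N_exact:
  fixes \<delta> \<beta> :: real
  assumes "0 < \<delta>" "0 < \<beta>" "\<beta> < 1"
  shows N_exact_le: "(\<Sum>i<d. real (N_exact \<delta> \<beta> d choose i) * \<delta> ^ i * (1 - \<delta>) ^ (N_exact \<delta> \<beta> d - i)) \<le> \<beta>"
    and N_exact_ge: "d \<le> N_exact \<delta> \<beta> d"
proof -
  let ?g = "\<lambda>n. \<Sum>i<d. real (n choose i) * \<delta> ^ i * (1 - \<delta>) ^ (n - i)"
  have "\<exists>n. ?g n \<le> \<beta>"
  proof (cases "\<delta> < 1")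
    case True
    have "\<forall>\<^sub>F n in sequentially. ?g n < \<beta>"
      using binomial_tail_tendsto_0[OF assms(1) True, of d] assms(2) by (rule order_tendstoD)
    then obtain n where "?g n < \<beta>" by (auto simp: eventually_sequentially)
    then show ?thesis by (intro exI[of _ n]) simp
  next
    case False
    \<comment> \<open>For \<open>\<delta> \<ge> 1\<close> the convergence fact does not apply, but
      \<open>n = d\<close> is a witness: the sum lacks only the term \<open>\<delta> ^ d\<close> of
      the complete expansion.\<close>
    have "?g d + \<delta> ^ d = (\<Sum>i<Suc d. real (d choose i) * \<delta> ^ i * (1 - \<delta>) ^ (d - i))" by simp
    also have "\<dots> = 1" by (rule binomial_sum_lessThan) simp
    finally have "?g d = 1 - \<delta> ^ d" by simp
    also have "\<dots> \<le> 0" using False by simp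
    finally show ?thesis using assms(2) by (intro exI[of _ d]) simp
  qed
  then show le: "?g (N_exact \<delta> \<beta> d) \<le> \<beta>" unfolding N_exact_def by (rule LeastI_ex)
  show "d \<le> N_exact \<delta> \<beta> d"
  proof (rule ccontr)
    assume "\<not> d \<le> N_exact \<delta> \<beta> d"
    then have "?g (N_exact \<delta> \<beta> d) = 1" by (intro binomial_sum_lessThan) simp
    then show False using le assms(3) by simp
  qed
qed

lemma measurable_N_exact:
  assumes [measurable]: "\<delta> \<in> borel_measurable L"
  shows "(\<lambda>\<omega>. N_exact (\<delta> \<omega>) \<beta> d) \<in> L \<rightarrow>\<^sub>M count_space UNIV"
  unfolding N_exact_def by measurable

lemma worst_caseD:
  assumes "worst_case P0 U \<delta> \<le> ereal \<epsilon>" "Q \<in> U" "A \<in> sets P0" "measure P0 A \<le> \<delta>"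
  shows "measure Q A \<le> \<epsilon>"
proof -
  have "ereal (measure Q A) \<le> worst_case P0 U \<delta>"
    unfolding worst_case_def using assms by (intro Sup_upper) blast
  then show ?thesis using assms(1) by (metis ereal_less_eq(3) order_trans)
qed

text \<open>Integration over the joint law needs the Monte Carlo sequence to be a kernel. On a
  cylinder its probability is a finite product of kernel values, and the cylinders form an
  intersection-stable generator.\<close>

lemma measurable_mc_law:
  assumes K: "K \<in> L \<rightarrow>\<^sub>M prob_algebra Y"
  shows "(\<lambda>\<omega>. mc_law (K \<omega>)) \<in> L \<rightarrow>\<^sub>M subprob_algebra (mc_law Y)"
proof -
  have K': "prob_space (K \<omega>)" "sets (K \<omega>) = sets Y" if "\<omega> \<in> space L" for \<omega>
    using measurable_space[OF K that] by (auto simp: space_prob_algebra)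
  have sp: "prob_space (mc_law (K \<omega>))" if "\<omega> \<in> space L" for \<omega>
    unfolding mc_law_def by (intro prob_space_PiM K' that)
  let ?G = "prod_algebra UNIV (\<lambda>_ :: nat. Y)"
  let ?\<Omega> = "\<Pi>\<^sub>E i\<in>(UNIV :: nat set). space Y"
  have cyl: "(\<lambda>\<omega>. emeasure (mc_law (K \<omega>)) A) \<in> borel_measurable L" if A_in: "A \<in> ?G" for A
  proof -
    obtain J E where A: "A = prod_emb UNIV (\<lambda>_. Y) J (Pi\<^sub>E J E)" "finite J" "\<And>j. j \<in> J \<Longrightarrow> E j \<in> sets Y"
      using A_in by (elim prod_algebraE) blast
    have "emeasure (mc_law (K \<omega>)) A = (\<Prod>j\<in>J. emeasure (K \<omega>) (E j))" if w: "\<omega> \<in> space L" for \<omega>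
    proof -
      interpret product_prob_space "\<lambda>_ :: nat. K \<omega>" UNIV
        using K'[OF w] by (simp add: product_prob_space_def product_prob_space_axioms_def product_sigma_finite_def prob_space_imp_sigma_finite)
      have "A = prod_emb UNIV (\<lambda>_. K \<omega>) J (Pi\<^sub>E J E)"
        using A(1) sets_eq_imp_space_eq[OF K'(2)[OF w]] by (simp add: prod_emb_def)
      then show ?thesis
        unfolding mc_law_def using A K'[OF w] by (simp add: emeasure_PiM_emb)
    qed
    moreover have "(\<lambda>\<omega>. \<Prod>j\<in>J. emeasure (K \<omega>) (E j)) \<in> borel_measurable L"
      using A(3) by (intro borel_measurable_prod_ennreal
        measurable_compose[OF measurable_prob_algebraD[OF K] measurable_emeasure_subprob_algebra])
    ultimately show ?thesis by (simp cong: measurable_cong)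
  qed
  show ?thesis
  proof (rule measurable_subprob_algebra_generated[where G = ?G and \<Omega> = ?\<Omega>])
    show "sets (mc_law Y) = sigma_sets ?\<Omega> ?G" by (simp add: mc_law_def sets_PiM)
    show "Int_stable ?G" by (rule Int_stable_prod_algebra)
    show "?G \<subseteq> Pow ?\<Omega>" by (rule prod_algebra_sets_into_space)
    show "subprob_space (mc_law (K \<omega>))" if "\<omega> \<in> space L" for \<omega>
      using sp[OF that] by (rule prob_space_imp_subprob_space)
    show "sets (mc_law (K \<omega>)) = sets (mc_law Y)" if "\<omega> \<in> space L" for \<omega>
      unfolding mc_law_def using K'(2)[OF that] by (intro sets_PiM_cong) auto
    show "(\<lambda>\<omega>. emeasure (mc_law (K \<omega>)) A) \<in> borel_measurable L" if "A \<in> ?G" for A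
      using that by (rule cyl)
    have "emeasure (mc_law (K \<omega>)) ?\<Omega> = 1" if "\<omega> \<in> space L" for \<omega>
    proof -
      have "?\<Omega> = space (mc_law (K \<omega>))"
        using sets_eq_imp_space_eq[OF K'(2)[OF that]] by (simp add: mc_law_def space_PiM)
      then show ?thesis using prob_space.emeasure_space_1[OF sp[OF that]] by simp
    qed
    then show "(\<lambda>\<omega>. emeasure (mc_law (K \<omega>)) ?\<Omega>) \<in> borel_measurable L"
      by (simp cong: measurable_cong)
  qed
qed

lemma (in scenario_program) prob_mc_violation_le:
  assumes "0 < \<delta>" "0 < \<beta>" "\<beta> < 1"
  defines "N \<equiv> N_exact \<delta> \<beta> DIM('a)"
  shows "{s \<in> space (mc_law M). \<delta> < violation (sol N s)} \<in> sets (mc_law M)" (is "?D \<in> _")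
    and "measure (mc_law M) {s \<in> space (mc_law M). \<delta> < violation (sol N s)} \<le> \<beta>"
proof -
  have N: "DIM('a) \<le> N" unfolding N_def using assms by (intro N_exact_ge)
  then have N1: "1 \<le> N" using DIM_positive[where 'a='a] by linarith
  show meas: "?D \<in> sets (mc_law M)"
    unfolding mc_law_def by (rule large_violation_sets[OF N1]) simp
  show "measure (mc_law M) ?D \<le> \<beta>"
  proof (cases "\<delta> < 1")
    case False
    \<comment> \<open>A probability cannot exceed \<open>\<delta> \<ge> 1\<close>; this case is
      separate because the binomial bound is available for \<open>\<delta> < 1\<close> only.\<close>
    then have "?D = {}" using prob_le_1 by (auto simp: violation_def not_less intro: order_trans)
    then have "measure (mc_law M) ?D = 0" by (simp only: measure_empty)
    then show ?thesis using assms(2) by linarith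
  next
    case True
    let ?P = "\<Pi>\<^sub>M i\<in>{..<N}. M"
    let ?D' = "{s \<in> space ?P. \<delta> < violation (sol N s)}"
    let ?r = "\<lambda>s. restrict s {..<N}"
    have r: "?r \<in> mc_law M \<rightarrow>\<^sub>M ?P" unfolding mc_law_def by (rule measurable_restrict_subset) simp
    have distr: "distr (mc_law M) ?P ?r = ?P"
      unfolding mc_law_def
      using distr_PiM_reindex[of "UNIV :: nat set" "\<lambda>_. M" "\<lambda>i. i" "{..<N}"] prob_space_axioms by simp
    have D': "?D' \<in> sets ?P" by (rule large_violation_sets[OF N1]) simp
    have "?r -` ?D' \<inter> space (mc_law M) = ?D"
      using measurable_space[OF r] by (auto simp: sol_restrict)
    then have "measure (mc_law M) ?D = measure (distr (mc_law M) ?P ?r) ?D'"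
      using measure_distr[OF r D'] by simp
    also have "\<dots> = measure ?P ?D'" by (simp only: distr)
    also have "\<dots> \<le> (\<Sum>i<DIM('a). real (N choose i) * \<delta> ^ i * (1 - \<delta>) ^ (N - i))"
      using N assms(1) True by (rule prob_large_violation_le)
    also have "\<dots> \<le> \<beta>" unfolding N_def using assms by (intro N_exact_le)
    finally show ?thesis .
  qed
qed

lemma cc_feasible_if_dro_feasible:
  assumes "dro_feasible X Xs U \<epsilon> x" "P \<in> U"
  shows "cc_feasible X Xs P \<epsilon> x"
proof -
  have "ereal (1 - \<epsilon>) \<le> (INF Q\<in>U. ereal \<P>(\<xi> in Q. x \<in> Xs \<xi>))"
    using assms(1) by (simp add: dro_feasible_def)
  also have "\<dots> \<le> ereal \<P>(\<xi> in P. x \<in> Xs \<xi>)" using assms(2) by (rule INF_lower)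
  finally show ?thesis using assms(1) by (simp add: cc_feasible_def dro_feasible_def)
qed

theorem theorem2p2p1:
  fixes Y :: "'y measure" and P :: "'y measure"
    and X :: "(real ^ 'd) set" and c :: "real ^ 'd" and Xs :: "'y \<Rightarrow> (real ^ 'd) set"
    and n :: nat and \<alpha> \<beta> \<epsilon> :: real
    and P0 :: "(nat \<Rightarrow> 'y) \<Rightarrow> 'y measure"
    and U :: "(nat \<Rightarrow> 'y) \<Rightarrow> 'y measure set"
    and \<delta> :: "(nat \<Rightarrow> 'y) \<Rightarrow> real"
    and xhat :: "(nat \<Rightarrow> 'y) \<Rightarrow> (nat \<Rightarrow> 'y) \<Rightarrow> real ^ 'd"
  defines "xhat \<equiv> \<lambda>\<omega>. sampled_solution c X Xs (N_exact (\<delta> \<omega>) \<beta> CARD('d))"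
  assumes P: "P \<in> space (prob_algebra Y)"
    and alpha: "0 < \<alpha>" "\<alpha> < 1" and beta: "0 < \<beta>" "\<beta> < 1" and eps: "0 < \<epsilon>"
    and Xs_subset: "\<And>\<xi>. \<xi> \<in> space Y \<Longrightarrow> Xs \<xi> \<subseteq> X"
    and Xs_convex: "\<And>\<xi>. \<xi> \<in> space Y \<Longrightarrow> convex (Xs \<xi>)"
    and region_interior: "\<And>N s. N \<ge> 1 \<Longrightarrow> (\<forall>i<N. s i \<in> space Y) \<Longrightarrow>
          interior (sampled_region X Xs N s) \<noteq> {}"
    and unique_solution: "\<And>N s. N \<ge> 1 \<Longrightarrow> (\<forall>i<N. s i \<in> space Y) \<Longrightarrow>
          \<exists>!x. is_arg_min (\<lambda>x. c \<bullet> x) (\<lambda>x. x \<in> sampled_region X Xs N s) x"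
    and Xs_meas: "Measurable.pred (borel \<Otimes>\<^sub>M Y) (\<lambda>(x, \<xi>). x \<in> Xs \<xi>)"
    and solution_meas: "\<And>N. N \<ge> 1 \<Longrightarrow>
          sampled_solution c X Xs N \<in> (\<Pi>\<^sub>M i\<in>{..<N}. Y) \<rightarrow>\<^sub>M borel"
    and P0_meas: "P0 \<in> data_law n Y \<rightarrow>\<^sub>M prob_algebra Y"
    and U_prob: "\<And>\<omega>. \<omega> \<in> space (data_law n Y) \<Longrightarrow> U \<omega> \<subseteq> space (prob_algebra Y)"
    and U_meas: "Measurable.pred (data_law n Y) (\<lambda>\<omega>. P \<in> U \<omega>)"
    and delta_meas: "\<delta> \<in> borel_measurable (data_law n Y)"
    and dro_meas: "\<And>\<omega>. \<omega> \<in> space (data_law n Y) \<Longrightarrow>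
          Measurable.pred (mc_law Y) (\<lambda>s. dro_feasible X Xs (U \<omega>) \<epsilon> (xhat \<omega> s))"
    and delta_pos: "\<And>\<omega>. \<omega> \<in> space (data_law n Y) \<Longrightarrow> 0 < \<delta> \<omega>"
    and delta: "\<And>\<omega>. \<omega> \<in> space (data_law n Y) \<Longrightarrow>
          worst_case (P0 \<omega>) (U \<omega>) (\<delta> \<omega>) \<le> ereal \<epsilon>"
  shows "(\<forall>\<omega> \<in> space (data_law n Y).
            \<P>(s in mc_law (P0 \<omega>). dro_feasible X Xs (U \<omega>) \<epsilon> (xhat \<omega> s)) \<ge> 1 - \<beta>) \<and>
         (\<P>(\<omega> in data_law n P. P \<in> U \<omega>) \<ge> 1 - \<alpha> \<longrightarrow>
            \<P>((\<omega>, s) in joint_law n P P0. cc_feasible X Xs P \<epsilon> (xhat \<omega> s)) \<ge> 1 - \<alpha> - \<beta>)"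
proof -
  \<comment> \<open>The assumptions refer only to the measurable space \<open>Y\<close>, so every
    probability law on it yields a scenario program.\<close>
  have program: "scenario_program Q X c Xs" if "Q \<in> space (prob_algebra Y)" for Q
  proof -
    have Q: "prob_space Q" "sets Q = sets Y" using that by (auto simp: space_prob_algebra)
    have spQ: "space Q = space Y" using Q(2) by (rule sets_eq_imp_space_eq)
    have pair: "sets (borel \<Otimes>\<^sub>M Q :: ((real ^ 'd) \<times> 'y) measure) = sets (borel \<Otimes>\<^sub>M Y)"
      using Q(2) by (intro sets_pair_measure_cong) auto
    have prod: "sets (\<Pi>\<^sub>M i\<in>{..<N}. Q) = sets (\<Pi>\<^sub>M i\<in>{..<N}. Y)" for N :: nat
      using Q(2) by (intro sets_PiM_cong) auto
    show ?thesis
    proof (intro scenario_program.intro scenario_program_axioms.intro Q(1))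
      show "Measurable.pred (borel \<Otimes>\<^sub>M Q) (\<lambda>(x, \<xi>). x \<in> Xs \<xi>)"
        using Xs_meas by (subst measurable_cong_sets[OF pair refl])
      show "sampled_solution c X Xs N \<in> (\<Pi>\<^sub>M i\<in>{..<N}. Q) \<rightarrow>\<^sub>M borel" if "1 \<le> N" for N
        using solution_meas[OF that] by (subst measurable_cong_sets[OF prod refl])
      show "\<exists>!x. is_arg_min (\<lambda>x. c \<bullet> x) (\<lambda>x. x \<in> sampled_region X Xs N s) x"
        if "1 \<le> N" "\<forall>i<N. s i \<in> space Q" for N s
        using unique_solution[OF that(1)] that(2) unfolding spQ by blast
    qed (use Xs_subset Xs_convex in \<open>simp_all add: spQ\<close>)
  qed
  have spmc: "s i \<in> space Y" if "s \<in> space (mc_law Q)" "sets Q = sets Y" for s i Q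
    using that sets_eq_imp_space_eq[OF that(2)] by (auto simp: mc_law_def space_PiM)
  have mc_sets: "sets (mc_law Q) = sets (mc_law Y)" if "sets Q = sets Y" for Q
    unfolding mc_law_def using that by (intro sets_PiM_cong) auto
  have N1: "1 \<le> N_exact (\<delta> \<omega>) \<beta> CARD('d)" if "\<omega> \<in> space (data_law n Y)" for \<omega>
    using N_exact_ge[OF delta_pos[OF that] beta, of "CARD('d)"] zero_less_card_finite[where 'a='d] by linarith
  have xhat_X: "xhat \<omega> s \<in> X" if "\<omega> \<in> space (data_law n Y)" "\<And>i. s i \<in> space Y" for \<omega> s
  proof -
    interpret scenario_program P X c Xs by (rule program[OF P])
    have "sets P = sets Y" using P by (simp add: space_prob_algebra)
    then have "space P = space Y" by (rule sets_eq_imp_space_eq)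
    then show ?thesis unfolding xhat_def using that by (intro sol_in_X N1) auto
  qed
  have first: "1 - \<beta> \<le> \<P>(s in mc_law (P0 \<omega>). dro_feasible X Xs (U \<omega>) \<epsilon> (xhat \<omega> s))"
    if w: "\<omega> \<in> space (data_law n Y)" for \<omega>
  proof -
    have P0w: "P0 \<omega> \<in> space (prob_algebra Y)" using measurable_space[OF P0_meas w] .
    then have setsP0: "sets (P0 \<omega>) = sets Y" by (simp add: space_prob_algebra)
    interpret S: scenario_program "P0 \<omega>" X c Xs by (rule program[OF P0w])
    interpret mc: prob_space "mc_law (P0 \<omega>)"
      unfolding mc_law_def by (intro prob_space_PiM S.prob_space_axioms)
    let ?D = "{s \<in> space (mc_law (P0 \<omega>)). \<delta> \<omega> < S.violation (xhat \<omega> s)}"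
    let ?F = "{s \<in> space (mc_law (P0 \<omega>)). dro_feasible X Xs (U \<omega>) \<epsilon> (xhat \<omega> s)}"
    have D: "?D \<in> mc.events" "mc.prob ?D \<le> \<beta>"
      using S.prob_mc_violation_le[OF delta_pos[OF w] beta] by (simp_all add: xhat_def)
    have "Measurable.pred (mc_law (P0 \<omega>)) (\<lambda>s. dro_feasible X Xs (U \<omega>) \<epsilon> (xhat \<omega> s))"
      using dro_meas[OF w] by (subst measurable_cong_sets[OF mc_sets[OF setsP0] refl])
    then have F: "?F \<in> mc.events" by measurable
    have "space (mc_law (P0 \<omega>)) - ?D \<subseteq> ?F"
    proof
      fix s assume s: "s \<in> space (mc_law (P0 \<omega>)) - ?D"
      have sY: "s i \<in> space Y" for i using s setsP0 by (intro spmc[of s "P0 \<omega>"]) auto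
      let ?x = "xhat \<omega> s"
      have V: "S.violation ?x \<le> \<delta> \<omega>" using s by (simp add: not_less)
      have "ereal (1 - \<epsilon>) \<le> ereal \<P>(\<xi> in Q. ?x \<in> Xs \<xi>)" if Q: "Q \<in> U \<omega>" for Q
      proof -
        have Qp: "prob_space Q" "sets Q = sets Y" using Q U_prob[OF w] by (auto simp: space_prob_algebra)
        interpret Q: prob_space Q by (rule Qp)
        have spQ: "space Q = space (P0 \<omega>)" using Qp setsP0 by (intro sets_eq_imp_space_eq) simp
        let ?A = "{\<xi> \<in> space (P0 \<omega>). ?x \<notin> Xs \<xi>}"
        have "measure Q ?A \<le> \<epsilon>"
          using delta[OF w] Q S.violating_sets V unfolding S.violation_def by (rule worst_caseD)
        moreover have "{\<xi> \<in> space Q. ?x \<in> Xs \<xi>} = space Q - ?A" using spQ by auto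
        moreover have "?A \<in> Q.events" using S.violating_sets setsP0 Qp by simp
        ultimately show ?thesis using Q.prob_compl[of ?A] by simp
      qed
      then have "dro_feasible X Xs (U \<omega>) \<epsilon> ?x"
        unfolding dro_feasible_def using xhat_X[OF w sY] by (auto intro: INF_greatest)
      then show "s \<in> ?F" using s by simp
    qed
    then have "mc.prob (space (mc_law (P0 \<omega>)) - ?D) \<le> mc.prob ?F" by (rule mc.finite_measure_mono[OF _ F])
    then show ?thesis using mc.prob_compl[OF D(1)] D(2) by simp
  qed
  have second: "1 - \<alpha> - \<beta> \<le> \<P>((\<omega>, s) in joint_law n P P0. cc_feasible X Xs P \<epsilon> (xhat \<omega> s))"
    if conf: "1 - \<alpha> \<le> \<P>(\<omega> in data_law n P. P \<in> U \<omega>)"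
  proof -
    have setsP: "sets P = sets Y" using P by (simp add: space_prob_algebra)
    interpret S: scenario_program P X c Xs by (rule program[OF P])
    interpret dl: prob_space "data_law n P"
      unfolding data_law_def by (intro prob_space_PiM S.prob_space_axioms)
    have dl_sets: "sets (data_law n P) = sets (data_law n Y)"
      unfolding data_law_def using setsP by (intro sets_PiM_cong) auto
    have dl_space: "space (data_law n P) = space (data_law n Y)" by (rule sets_eq_imp_space_eq[OF dl_sets])
    let ?B = "data_law n P \<Otimes>\<^sub>M mc_law P"
    define \<kappa> where "\<kappa> \<omega> = distr (mc_law (P0 \<omega>)) ?B (Pair \<omega>)" for \<omega>
    have "P0 \<in> data_law n P \<rightarrow>\<^sub>M prob_algebra Y"
      using P0_meas by (subst measurable_cong_sets[OF dl_sets refl])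
    then have "(\<lambda>\<omega>. mc_law (P0 \<omega>)) \<in> data_law n P \<rightarrow>\<^sub>M subprob_algebra (mc_law Y)"
      by (rule measurable_mc_law)
    then have mcP0: "(\<lambda>\<omega>. mc_law (P0 \<omega>)) \<in> data_law n P \<rightarrow>\<^sub>M subprob_algebra (mc_law P)"
      by (simp only: subprob_algebra_cong[OF mc_sets[OF setsP]])
    have \<kappa>: "\<kappa> \<in> data_law n P \<rightarrow>\<^sub>M subprob_algebra ?B"
      unfolding \<kappa>_def[abs_def] using mcP0 by (intro measurable_distr2) (simp_all add: case_prod_Pair)
    have joint: "joint_law n P P0 = data_law n P \<bind> \<kappa>" by (simp add: joint_law_def \<kappa>_def[abs_def])
    \<comment> \<open>Measurability of \<open>dro_feasible\<close> is assumed only for each fixed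
      \<open>\<omega>\<close>, so the joint argument uses this event instead. It is expressed
      through the violation probability under \<open>P\<close>, is jointly measurable, and agrees
      with \<open>cc_feasible\<close> on \<open>space ?B\<close>.\<close>
    define CC where "CC = {z \<in> space ?B. S.violation (xhat (fst z) (snd z)) \<le> \<epsilon>}"
    have xhat_meas: "(\<lambda>z. xhat (fst z) (snd z)) \<in> ?B \<rightarrow>\<^sub>M borel"
    proof -
      \<comment> \<open>The sample size varies with the data but takes countably many values, so
        fixed sizes suffice. \<open>max 1 i\<close> avoids the size 0, to which the measurability
        assumption does not extend; as \<open>N_exact\<close> is at least 1 here, the value is
        unchanged.\<close>
      have sol: "(\<lambda>z. S.sol (max 1 i) (snd z)) \<in> ?B \<rightarrow>\<^sub>M borel" for i
        unfolding mc_law_def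
        by (rule measurable_compose[OF measurable_snd S.measurable_sol]) auto
      have "\<delta> \<in> borel_measurable (data_law n P)"
        using delta_meas by (subst measurable_cong_sets[OF dl_sets refl])
      then have "(\<lambda>z. N_exact (\<delta> (fst z)) \<beta> CARD('d)) \<in> ?B \<rightarrow>\<^sub>M count_space UNIV"
        by (intro measurable_compose[OF measurable_fst measurable_N_exact])
      from measurable_compose_countable[OF sol this]
      have meas: "(\<lambda>z. S.sol (max 1 (N_exact (\<delta> (fst z)) \<beta> CARD('d))) (snd z)) \<in> ?B \<rightarrow>\<^sub>M borel" .
      have eq: "S.sol (max 1 (N_exact (\<delta> (fst z)) \<beta> CARD('d))) (snd z) = xhat (fst z) (snd z)"
        if "z \<in> space ?B" for z
      proof -
        have "fst z \<in> space (data_law n Y)"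
          using that by (simp add: space_pair_measure mem_Times_iff dl_space)
        then have "max 1 (N_exact (\<delta> (fst z)) \<beta> CARD('d)) = N_exact (\<delta> (fst z)) \<beta> CARD('d)"
          by (intro max_absorb2 N1)
        then show ?thesis by (simp only: xhat_def)
      qed
      show ?thesis by (rule iffD1[OF measurable_cong[OF eq] meas])
    qed
    have "(\<lambda>z. S.violation (xhat (fst z) (snd z))) \<in> borel_measurable ?B"
      by (rule measurable_compose[OF xhat_meas S.violation_measurable])
    then have CC: "CC \<in> sets ?B" unfolding CC_def by measurable
    have cc_iff: "cc_feasible X Xs P \<epsilon> (xhat \<omega> s) \<longleftrightarrow> S.violation (xhat \<omega> s) \<le> \<epsilon>"
      if "(\<omega>, s) \<in> space ?B" for \<omega> s
    proof -
      have ws: "\<omega> \<in> space (data_law n Y)" "s \<in> space (mc_law P)"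
        using that by (simp_all add: space_pair_measure dl_space)
      have X: "xhat \<omega> s \<in> X" using ws(1) spmc[OF ws(2) setsP] by (rule xhat_X)
      let ?A = "{\<xi> \<in> space P. xhat \<omega> s \<notin> Xs \<xi>}"
      have "{\<xi> \<in> space P. xhat \<omega> s \<in> Xs \<xi>} = space P - ?A" by auto
      then show ?thesis
        using X S.prob_compl[OF S.violating_sets[of "xhat \<omega> s"]] by (auto simp: cc_feasible_def S.violation_def)
    qed
    have space_joint: "space (joint_law n P P0) = space ?B"
    proof -
      have "sets (\<kappa> \<omega>) = sets ?B" for \<omega> by (simp add: \<kappa>_def)
      then have "sets (data_law n P \<bind> \<kappa>) = sets ?B" using dl.not_empty by (intro sets_bind)
      then show ?thesis unfolding joint by (rule sets_eq_imp_space_eq)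
    qed
    \<comment> \<open>When \<open>P\<close> lies in \<open>U \<omega>\<close>, robust feasibility
      implies feasibility under \<open>P\<close>, so the conditional bound of the first part
      applies; for other data the indicator vanishes.\<close>
    have kernel_ge: "(1 - \<beta>) * indicator {\<omega> \<in> space (data_law n P). P \<in> U \<omega>} \<omega> \<le> measure (\<kappa> \<omega>) CC"
      if w: "\<omega> \<in> space (data_law n P)" for \<omega>
    proof (cases "P \<in> U \<omega>")
      case False
      then show ?thesis by simp
    next
      case True
      have wY: "\<omega> \<in> space (data_law n Y)" using w dl_space by simp
      have P0w: "P0 \<omega> \<in> space (prob_algebra Y)" using measurable_space[OF P0_meas wY] .
      then have setsP0: "sets (P0 \<omega>) = sets Y" by (simp add: space_prob_algebra)
      have "prob_space (P0 \<omega>)" using P0w by (simp add: space_prob_algebra)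
      then interpret mc: prob_space "mc_law (P0 \<omega>)" unfolding mc_law_def by (intro prob_space_PiM)
      have mcs: "sets (mc_law (P0 \<omega>)) = sets (mc_law P)" using mc_sets[OF setsP0] mc_sets[OF setsP] by simp
      have msp: "space (mc_law (P0 \<omega>)) = space (mc_law P)" using mcs by (rule sets_eq_imp_space_eq)
      have Pair: "Pair \<omega> \<in> mc_law (P0 \<omega>) \<rightarrow>\<^sub>M ?B"
        using measurable_Pair1'[OF w, of "mc_law P"] by (subst measurable_cong_sets[OF mcs refl])
      let ?F = "{s \<in> space (mc_law (P0 \<omega>)). dro_feasible X Xs (U \<omega>) \<epsilon> (xhat \<omega> s)}"
      have "?F \<subseteq> Pair \<omega> -` CC \<inter> space (mc_law (P0 \<omega>))"
      proof
        fix s assume s: "s \<in> ?F"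
        have B: "(\<omega>, s) \<in> space ?B" using s w msp by (simp add: space_pair_measure)
        have "cc_feasible X Xs P \<epsilon> (xhat \<omega> s)" using s True by (intro cc_feasible_if_dro_feasible) auto
        then show "s \<in> Pair \<omega> -` CC \<inter> space (mc_law (P0 \<omega>))"
          using cc_iff[OF B] B s by (simp add: CC_def)
      qed
      then have "mc.prob ?F \<le> mc.prob (Pair \<omega> -` CC \<inter> space (mc_law (P0 \<omega>)))"
        using measurable_sets[OF Pair CC] by (rule mc.finite_measure_mono)
      also have "\<dots> = measure (\<kappa> \<omega>) CC" unfolding \<kappa>_def by (rule measure_distr[symmetric, OF Pair CC])
      finally show ?thesis using first[OF wY] w True by simp
    qed
    have Uset: "{\<omega> \<in> space (data_law n P). P \<in> U \<omega>} \<in> dl.events"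
      using U_meas unfolding dl_space dl_sets by measurable
    have \<kappa>1: "measure (\<kappa> \<omega>) CC \<le> 1" if "\<omega> \<in> space (data_law n P)" for \<omega>
    proof -
      have "subprob_space (\<kappa> \<omega>)" using measurable_space[OF \<kappa> that] by (simp add: space_subprob_algebra)
      then show ?thesis by (rule subprob_space.subprob_measure_le_1)
    qed
    \<comment> \<open>The two sides differ by \<open>\<alpha> * \<beta>\<close>. The confidence
      levels multiply because the Monte Carlo bound holds conditionally on the data.\<close>
    have "1 - \<alpha> - \<beta> \<le> (1 - \<beta>) * (1 - \<alpha>)" using alpha beta by (simp add: algebra_simps)
    also have "\<dots> \<le> (1 - \<beta>) * dl.prob {\<omega> \<in> space (data_law n P). P \<in> U \<omega>}"
      using conf beta by (intro mult_left_mono) auto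
    also have "\<dots> = dl.expectation (\<lambda>\<omega>. (1 - \<beta>) * indicator {\<omega> \<in> space (data_law n P). P \<in> U \<omega>} \<omega>)"
      using Uset by simp
    also have "\<dots> \<le> dl.expectation (\<lambda>\<omega>. measure (\<kappa> \<omega>) CC)"
    proof (rule integral_mono)
      show "integrable (data_law n P) (\<lambda>\<omega>. (1 - \<beta>) * indicat_real {\<omega> \<in> space (data_law n P). P \<in> U \<omega>} \<omega>)"
        using Uset by (intro integrable_mult_right) (simp add: dl.emeasure_eq_measure)
      show "integrable (data_law n P) (\<lambda>\<omega>. measure (\<kappa> \<omega>) CC)"
        using \<kappa>1 by (intro dl.integrable_const_bound[of _ 1] AE_I2
            measurable_compose[OF \<kappa> measurable_measure_subprob_algebra[OF CC]]) auto
    qed (rule kernel_ge)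
    also have "\<dots> = measure (joint_law n P P0) CC"
      unfolding joint by (rule dl.measure_bind[symmetric, OF \<kappa> CC])
    also have "\<dots> = \<P>((\<omega>, s) in joint_law n P P0. cc_feasible X Xs P \<epsilon> (xhat \<omega> s))"
      unfolding CC_def space_joint[symmetric]
      by (rule arg_cong[of _ _ "measure _"]) (auto simp: space_joint cc_iff)
    finally show ?thesis .
  qed
  show ?thesis using first second by blast
qed

end
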